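(* In the partially functional linear model described in the context, suppose that $\mathrm E(\varepsilon\mid\boldsymbol X,Y)=0$, $\mathrm E(\varepsilon^2\mid\boldsymbol X,Y)<\sigma^2$, $\mathrm E\boldsymbol X=\boldsymbol 0$, and that there is a variance-dependent constant $K_{\sigma^2}>0$ such that for all different $\beta_1,\beta_2\in\mathcal H(K)$ and all $\boldsymbol\alpha_1,\boldsymbol\alpha_2\in\mathbb R^p$, $$K(P_{\boldsymbol\alpha_1,\beta_1}\,|\,P_{\boldsymbol\alpha_2,\beta_2})=\mathrm E_{\boldsymbol\alpha_1,\beta_1}\Bigl(\log\frac{dP_{\boldsymbol\alpha_1,\beta_1}}{dP_{\boldsymbol\alpha_2,\beta_2}}\Bigr)\le K_{\sigma^2}\,\mathrm E\bigl[\langle Y,\beta_1-\beta_2\rangle+\boldsymbol X^T(\boldsymbol\alpha_1-\boldsymbol\alpha_2)\bigr]^2 .$$ Suppose the eigenvalues $\{\tau_k\}_{k\ge1}$ of $T$ satisfy $\tau_k=t_0k^{-2r}$ for some $r,t_0\in(0,\infty)$. Then for every $\rho\in(0,\frac18)$ there exists a sequence $\{N_n\}_{n\ge1}$ satisfying $$\log N_n\ge\left[\left(\frac{8(t_0+\lambda_{\max}(D))K_{\sigma^2}}{\rho\log2}\right)^{\frac1{1+2r}}n^{\frac1{1+2r}}+\left(\frac{8(t_0+\lambda_{\max}(D))K_{\sigma^2}}{\rho\log2}\right)^{\frac{2r}{1+2r}}n^{\frac{2r}{1+2r}}\right]\frac{\log2}{8}$$ such that, when $n\ge\frac{\rho\log2}{8t_0K_{\sigma^2}}$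 and $p=O(n^{\frac{2r}{1+2r}})<n$, $$\inf_{\tilde\eta}\ \sup_{\eta_0\in\mathbb R^p\times\mathcal H(K)}P\left(\mathcal E(\tilde\eta)-\mathcal E(\eta_0)\ge\left(\frac{8(t_0+\lambda_{\max}(D))K_{\sigma^2}}{\rho\log2}\right)^{-\frac{2r}{1+2r}}\cdot\frac{2^{-2r}t_0+\lambda_{\min}(D)}{2^{2r+3}n^{\frac{2r}{1+2r}}}\right)\ge\frac{\sqrt{N_n}}{1+\sqrt{N_n}}\left(1-4\rho-\sqrt{\frac{4\rho}{\log N_n}}\right).$$ Here a prediction rule $\tilde\eta$ is identified with an arbitrary estimator $(\tilde{\boldsymbol\alpha},\tilde\beta)$ based on the training samples $\{(Z_i,\boldsymbol X_i,Y_i)\}_{i=1}^n$, $\eta_0$ is identified with the true parameter $(\boldsymbol\alpha_0,\beta_0)$, and $P$ is the probability on the product space of the training samples generated by $\eta_0=(\boldsymbol\alpha_0,\beta_0)$.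
   Context: Setting. $\mathcal T\subset\mathbb R$ is compact; $L^2(\mathcal T)$ has inner product $\langle\cdot,\cdot\rangle$ and norm $\|\cdot\|$. The model with parameter $(\boldsymbol\alpha_0,\beta_0)$ is $Z=\boldsymbol X^T\boldsymbol\alpha_0+\langle Y,\beta_0\rangle+\varepsilon$, where $\boldsymbol X$ is a random vector in $\mathbb R^p$, $Y$ is a random function with values in $L^2(\mathcal T)$, $\boldsymbol X$ and $Y$ are independent, and $\mathrm EY(t)=0$. The training samples $(Z_i,\boldsymbol X_i,Y_i)$, $i=1,\dots,n$, are i.i.d. copies of $(Z,\boldsymbol X,Y)$. $P_{\boldsymbol\alpha,\beta}$ is the law of a single sample $(Z,\boldsymbol X,Y)$ when the true parameter is $(\boldsymbol\alpha,\beta)$, and $\mathrm E_{\boldsymbol\alpha,\beta}$ is expectation under it; $K(P\,|\,Q)$ denotes the Kullback–Leibler distance. Kernel. $K:\mathcal T\times\mathcal T\to\mathbb R$ is a continuous symmetric nonnegative definite kernel; for a square integrable kernel $R$, $L_R(f)(t)=\int_{\mathcal T}R(s,t)f(s)\,ds$; $L_K^{1/2}$ is the nonnegative square root of $L_K$. The RKHS is $\mathcal H(K)=L_K^{1/2}(L^2(\mathcal T))$ with norm $\|L_K^{1/2}f\|_K=\|f\|$, assumed dense in $L^2(\mathcal T)$ with $L_K^{1/2}$ injective. Covariances. $D:=\mathrm E(\boldsymbol X\boldsymbol X^T)$ with largest and smallest eigenvalues $\lambda_{\max}(D),\lambda_{\min}(D)$; $C(s,t):=\mathrm E(Y(s)Y(t))$;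 $T:=L_K^{1/2}L_CL_K^{1/2}$, a compact operator with eigenvalues $\tau_1\ge\tau_2\ge\cdots$. Risk. A parameter $(\boldsymbol\alpha,\beta)$ defines the prediction rule $\eta(\boldsymbol X,Y)=\boldsymbol X^T\boldsymbol\alpha+\langle Y,\beta\rangle$, and $\mathcal E(\eta):=\mathrm E[Z^*-\eta(\boldsymbol X^*,Y^* )]^2$, where $(Z^*,\boldsymbol X^*,Y^* )$ is a copy of $(Z,\boldsymbol X,Y)$ (under the true parameter) independent of the training samples, the expectation being over this copy only; so $\mathcal E(\tilde\eta)-\mathcal E(\eta_0)=\mathrm E[\tilde\eta(\boldsymbol X^*,Y^* )-\eta_0(\boldsymbol X^*,Y^* )]^2$, a function of the training samples. *)

theory Defs
  imports
    "HOL-Probability.Probability"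
    "HOL-Library.Landau_Symbols"
    "Jordan_Normal_Form.Char_Poly"
begin

text \<open>
  Elements of \<open>L\<^sup>2(T)\<close> are represented by functions on the reals, of which only the values on
  \<open>T\<close> matter. The equality of \<open>L\<^sup>2(T)\<close> is the relation \<open>L2_eq\<close>, not HOL equality, and operators
  on \<open>L\<^sup>2(T)\<close> are functions on representatives.
\<close>

definition L2 :: "real set \<Rightarrow> (real \<Rightarrow> real) set" where
  "L2 T = {f \<in> borel_measurable (lebesgue_on T). integrable (lebesgue_on T) (\<lambda>t. (f t)\<^sup>2)}"

definition L2_inner :: "real set \<Rightarrow> (real \<Rightarrow> real) \<Rightarrow> (real \<Rightarrow> real) \<Rightarrow> real" where
  "L2_inner T f g = (LINT t|lebesgue_on T. f t * g t)"

definition L2_norm :: "real set \<Rightarrow> (real \<Rightarrow> real) \<Rightarrow> real" where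
  "L2_norm T f = sqrt (L2_inner T f f)"

definition L2_eq :: "real set \<Rightarrow> (real \<Rightarrow> real) \<Rightarrow> (real \<Rightarrow> real) \<Rightarrow> bool" where
  "L2_eq T f g \<longleftrightarrow> (AE t in lebesgue_on T. f t = g t)"

definition L2_open :: "real set \<Rightarrow> (real \<Rightarrow> real) set \<Rightarrow> bool" where
  "L2_open T U \<longleftrightarrow> U \<subseteq> L2 T \<and>
     (\<forall>f\<in>U. \<exists>e>0. \<forall>g\<in>L2 T. L2_norm T (\<lambda>t. g t - f t) < e \<longrightarrow> g \<in> U)"

definition L2_borel :: "real set \<Rightarrow> (real \<Rightarrow> real) measure" where
  "L2_borel T = sigma (L2 T) {U. L2_open T U}"

definition L2_dense :: "real set \<Rightarrow> (real \<Rightarrow> real) set \<Rightarrow> bool" where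
  "L2_dense T H \<longleftrightarrow> (\<forall>f\<in>L2 T. \<forall>e>0. \<exists>h\<in>H. L2_norm T (\<lambda>t. f t - h t) < e)"

definition L2_injective :: "real set \<Rightarrow> ((real \<Rightarrow> real) \<Rightarrow> (real \<Rightarrow> real)) \<Rightarrow> bool" where
  "L2_injective T A \<longleftrightarrow> (\<forall>f\<in>L2 T. \<forall>g\<in>L2 T. L2_eq T (A f) (A g) \<longrightarrow> L2_eq T f g)"

definition nonneg_def_kernel :: "real set \<Rightarrow> (real \<Rightarrow> real \<Rightarrow> real) \<Rightarrow> bool" where
  "nonneg_def_kernel T K \<longleftrightarrow>
     (\<forall>F a. finite F \<and> F \<subseteq> T \<longrightarrow> 0 \<le> (\<Sum>s\<in>F. \<Sum>t\<in>F. a s * a t * K s t))"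

definition square_integrable_kernel :: "real set \<Rightarrow> (real \<Rightarrow> real \<Rightarrow> real) \<Rightarrow> bool" where
  "square_integrable_kernel T R \<longleftrightarrow>
     (\<lambda>(s, t). R s t) \<in> borel_measurable (lebesgue_on T \<Otimes>\<^sub>M lebesgue_on T) \<and>
     integrable (lebesgue_on T \<Otimes>\<^sub>M lebesgue_on T) (\<lambda>(s, t). (R s t)\<^sup>2)"

definition integral_op ::
  "real set \<Rightarrow> (real \<Rightarrow> real \<Rightarrow> real) \<Rightarrow> (real \<Rightarrow> real) \<Rightarrow> (real \<Rightarrow> real)" where
  "integral_op T R f = (\<lambda>t. LINT s|lebesgue_on T. R s t * f s)"

text \<open>
  \<open>S\<close> is the nonnegative (self-adjoint) square root of \<open>A\<close>; it is unique up to \<open>L2_eq\<close>.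
  Boundedness and compatibility with \<open>L2_eq\<close> follow from the symmetry of \<open>S\<close>.
\<close>

definition nonneg_sqrt ::
  "real set \<Rightarrow> ((real \<Rightarrow> real) \<Rightarrow> (real \<Rightarrow> real)) \<Rightarrow> ((real \<Rightarrow> real) \<Rightarrow> (real \<Rightarrow> real)) \<Rightarrow> bool" where
  "nonneg_sqrt T A S \<longleftrightarrow>
     (\<forall>f\<in>L2 T. S f \<in> L2 T) \<and>
     (\<forall>f\<in>L2 T. \<forall>g\<in>L2 T. \<forall>a b.
        L2_eq T (S (\<lambda>t. a * f t + b * g t)) (\<lambda>t. a * S f t + b * S g t)) \<and>
     (\<forall>f\<in>L2 T. \<forall>g\<in>L2 T. L2_inner T (S f) g = L2_inner T f (S g)) \<and>
     (\<forall>f\<in>L2 T. 0 \<le> L2_inner T (S f) f) \<and>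
     (\<forall>f\<in>L2 T. L2_eq T (S (S f)) (A f))"

definition rkhs :: "real set \<Rightarrow> ((real \<Rightarrow> real) \<Rightarrow> (real \<Rightarrow> real)) \<Rightarrow> (real \<Rightarrow> real) set" where
  "rkhs T S = {h \<in> L2 T. \<exists>f\<in>L2 T. L2_eq T h (S f)}"

text \<open>The eigenspace of \<open>A\<close> for \<open>\<mu>\<close> has dimension \<open>m\<close> (an orthonormal basis of \<open>m\<close> elements).\<close>

definition has_multiplicity ::
  "real set \<Rightarrow> ((real \<Rightarrow> real) \<Rightarrow> (real \<Rightarrow> real)) \<Rightarrow> real \<Rightarrow> nat \<Rightarrow> bool" where
  "has_multiplicity T A \<mu> m \<longleftrightarrow>
     (\<exists>e :: nat \<Rightarrow> real \<Rightarrow> real.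
        (\<forall>i<m. e i \<in> L2 T) \<and>
        (\<forall>i<m. \<forall>j<m. L2_inner T (e i) (e j) = (if i = j then 1 else 0)) \<and>
        (\<forall>f\<in>L2 T. L2_eq T (A f) (\<lambda>t. \<mu> * f t) \<longleftrightarrow>
           (\<exists>c. L2_eq T f (\<lambda>t. \<Sum>i<m. c i * e i t))))"

text \<open>
  \<open>\<tau> 1 \<ge> \<tau> 2 \<ge> \<dots>\<close> are the eigenvalues of the compact operator \<open>A\<close>: every nonzero real number is
  listed as often as its multiplicity as an eigenvalue (so not at all if it is none). As usual,
  zero entries only pad the list, and the dimension of the null space is not recorded.
\<close>

definition eigenvalue_sequence ::
  "real set \<Rightarrow> ((real \<Rightarrow> real) \<Rightarrow> (real \<Rightarrow> real)) \<Rightarrow> (nat \<Rightarrow> real) \<Rightarrow> bool" where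
  "eigenvalue_sequence T A \<tau> \<longleftrightarrow>
     (\<forall>k\<ge>1. \<tau> (Suc k) \<le> \<tau> k) \<and>
     (\<forall>\<mu>. \<mu> \<noteq> 0 \<longrightarrow> finite {k. 1 \<le> k \<and> \<tau> k = \<mu>} \<and>
        has_multiplicity T A \<mu> (card {k. 1 \<le> k \<and> \<tau> k = \<mu>}))"

text \<open>
  Vectors in \<open>\<real>\<^sup>p\<close> are functions on \<open>{..<p}\<close> (extended by \<open>undefined\<close>), because \<open>p\<close> varies with
  the sample size.
\<close>

definition Rvec :: "nat \<Rightarrow> (nat \<Rightarrow> real) measure" where
  "Rvec p = (\<Pi>\<^sub>M i\<in>{..<p}. borel)"

definition vdot :: "nat \<Rightarrow> (nat \<Rightarrow> real) \<Rightarrow> (nat \<Rightarrow> real) \<Rightarrow> real" where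
  "vdot p x a = (\<Sum>i<p. x i * a i)"

definition second_moment_mat :: "'w measure \<Rightarrow> nat \<Rightarrow> ('w \<Rightarrow> nat \<Rightarrow> real) \<Rightarrow> real mat" where
  "second_moment_mat M p X = Matrix.mat p p (\<lambda>(i, j). LINT \<omega>|M. X \<omega> i * X \<omega> j)"

definition lambda_max :: "real mat \<Rightarrow> real" where
  "lambda_max D = Max {l. eigenvalue D l}"

definition lambda_min :: "real mat \<Rightarrow> real" where
  "lambda_min D = Min {l. eigenvalue D l}"

definition covariance_fun :: "'w measure \<Rightarrow> ('w \<Rightarrow> real \<Rightarrow> real) \<Rightarrow> real \<Rightarrow> real \<Rightarrow> real" where
  "covariance_fun M Y s t = (LINT \<omega>|M. Y \<omega> s * Y \<omega> t)"

type_synonym obs = "real \<times> (nat \<Rightarrow> real) \<times> (real \<Rightarrow> real)"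
type_synonym param = "(nat \<Rightarrow> real) \<times> (real \<Rightarrow> real)"

definition obs_space :: "real set \<Rightarrow> nat \<Rightarrow> obs measure" where
  "obs_space T p = borel \<Otimes>\<^sub>M (Rvec p \<Otimes>\<^sub>M L2_borel T)"

text \<open>Independence as in \<open>prob_space.indep_var\<close>, which requires both variables to have the same type.\<close>

definition indep_rvs ::
  "'w measure \<Rightarrow> 'a measure \<Rightarrow> ('w \<Rightarrow> 'a) \<Rightarrow> 'b measure \<Rightarrow> ('w \<Rightarrow> 'b) \<Rightarrow> bool" where
  "indep_rvs M A X B Y \<longleftrightarrow> X \<in> measurable M A \<and> Y \<in> measurable M B \<and>
     prob_space.indep_set M {X -` U \<inter> space M | U. U \<in> sets A} {Y -` V \<inter> space M | V. V \<in> sets B}"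

definition predict :: "real set \<Rightarrow> nat \<Rightarrow> param \<Rightarrow> (nat \<Rightarrow> real) \<Rightarrow> (real \<Rightarrow> real) \<Rightarrow> real" where
  "predict T p \<theta> x y = vdot p x (fst \<theta>) + L2_inner T y (snd \<theta>)"

text \<open>The law of a single observation \<open>(Z, X, Y)\<close> when the true parameter is \<open>\<theta>\<close>.\<close>

definition obs_law ::
  "'w measure \<Rightarrow> real set \<Rightarrow> nat \<Rightarrow> ('w \<Rightarrow> nat \<Rightarrow> real) \<Rightarrow> ('w \<Rightarrow> real \<Rightarrow> real) \<Rightarrow> ('w \<Rightarrow> real)
     \<Rightarrow> param \<Rightarrow> obs measure" where
  "obs_law M T p X Y eps \<theta> =
     distr M (obs_space T p) (\<lambda>\<omega>. (predict T p \<theta> (X \<omega>) (Y \<omega>) + eps \<omega>, X \<omega>, Y \<omega>))"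

text \<open>
  The divergence of \<open>P\<close> from \<open>Q\<close>. The reference measure is the second argument here, but the first
  one in \<^const>\<open>KL_divergence\<close>. The library function is only meaningful in the first branch; outside
  it the divergence is infinite, since the negative part of the log-density is always integrable.
\<close>

definition KL_dist :: "'a measure \<Rightarrow> 'a measure \<Rightarrow> ereal" where
  "KL_dist P Q =
     (if absolutely_continuous Q P \<and> integrable P (entropy_density (exp 1) Q P)
      then ereal (KL_divergence (exp 1) Q P) else \<infinity>)"

text \<open>The prediction risk of \<open>\<theta>\<close> on a fresh observation with law \<open>P\<close>.\<close>

definition risk :: "real set \<Rightarrow> nat \<Rightarrow> obs measure \<Rightarrow> param \<Rightarrow> real" where
  "risk T p P \<theta> = (LINT (z, x, y)|P. (z - predict T p \<theta> x y)\<^sup>2)"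

definition estimators :: "real set \<Rightarrow> nat \<Rightarrow> nat \<Rightarrow> ((nat \<Rightarrow> obs) \<Rightarrow> param) set" where
  "estimators T p n = measurable (\<Pi>\<^sub>M i\<in>{1..n}. obs_space T p) (Rvec p \<Otimes>\<^sub>M L2_borel T)"

definition excess_risk_prob ::
  "real set \<Rightarrow> nat \<Rightarrow> nat \<Rightarrow> obs measure \<Rightarrow> param \<Rightarrow> ((nat \<Rightarrow> obs) \<Rightarrow> param) \<Rightarrow> real \<Rightarrow> real" where
  "excess_risk_prob T p n P \<theta> est \<delta> =
     measure (\<Pi>\<^sub>M i\<in>{1..n}. P)
       {s \<in> space (\<Pi>\<^sub>M i\<in>{1..n}. P). risk T p P (est s) - risk T p P \<theta> \<ge> \<delta>}"

end

theory Submission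
  imports Defs
begin

text \<open>
  The parameter set $\<real>^p \times \mathcal H(K)$ is unbounded and infinite dimensional, and the lower
  bound is a consequence of that: whatever the threshold \<open>\<delta>\<close> and the sample size, no estimator keeps
  the probability of an excess risk of at least \<open>\<delta>\<close> away from one on the whole parameter set, so that the
  minimax probability equals one. The claimed bound
  $\sqrt N/(1+\sqrt N)\,(1-4\rho-\sqrt{4\rho/\log N})$ is at most one for every $N \ge 2$, and \<open>N n\<close>
  only has to be taken as large as the first inequality demands.

  The mechanism is the usual reduction to a testing problem. Let $\phi_1, \phi_2, \ldots$ be
  eigenfunctions of $T = L_K^{1/2} L_C L_K^{1/2}$ for its simple eigenvalues $\tau_j > 0$, scaled to
  $\|\phi_j\|^2 = B/\tau_j$. The slopes $\beta_j = L_K^{1/2}\phi_j$ then satisfy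
  $\mathrm E\langle Y,\beta_i\rangle\langle Y,\beta_j\rangle = B$ for $i = j$ and $0$ otherwise
  (\<open>orthogonal_slopes\<close>). All of them are equally far from the slope $0$, hence by the
  Kullback--Leibler condition the laws $P_{\beta_j}$ have a divergence from $P_0$ that is bounded by a
  constant, while any two of them have squared prediction distance $2B$. If $B$ is large compared with \<open>\<delta>\<close>
  and with the noise level, an estimate of excess risk less than \<open>\<delta>\<close> under $\beta_j$ determines
  $j$ (\<open>small_excess_risk_imp_close\<close>). The corresponding events are disjoint for infinitely many
  hypotheses of bounded divergence from one product law $P_0^n$, and for a fixed \<open>n\<close> this forces their
  probabilities under $P_{\beta_j}^n$ to come arbitrarily close to zero
  (\<open>disjoint_events_bounded_KL\<close>). This is the form of Fano's argument in which the number of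
  hypotheses tends to infinity while their radius stays fixed.

  Two analytic points carry the rest. The identity
  $\mathrm E\langle Y,b\rangle^2 = \int\!\!\int C(s,t)\,b(s)\,b(t)\,ds\,dt$ holds although
  $\mathrm E\|Y\|^2$ may be infinite (\<open>pairing_second_moment\<close>): Fubini's theorem only applies after a
  truncation, and the square integrability of $C$ controls the remainder. And the risk is a measurable function of the
  estimate (\<open>risk_measurable\<close>), because it depends on the slope through root mean squares of
  residuals, which are Lipschitz in $L^2$.
\<close>

section \<open>Square-integrable functions\<close>

lemma integrable_mult_of_squares:
  fixes f g :: "'a \<Rightarrow> real"
  assumes [measurable]: "f \<in> borel_measurable M" "g \<in> borel_measurable M"
    and "integrable M (\<lambda>x. (f x)\<^sup>2)" "integrable M (\<lambda>x. (g x)\<^sup>2)"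
  shows "integrable M (\<lambda>x. f x * g x)"
proof (rule Bochner_Integration.integrable_bound)
  show "integrable M (\<lambda>x. (f x)\<^sup>2 + (g x)\<^sup>2)" using assms by simp
  have "\<bar>f x * g x\<bar> \<le> (f x)\<^sup>2 + (g x)\<^sup>2" for x
  proof -
    have "2 * \<bar>f x * g x\<bar> \<le> (f x)\<^sup>2 + (g x)\<^sup>2"
      using sum_squares_bound[of "\<bar>f x\<bar>" "\<bar>g x\<bar>"] by (simp add: abs_mult)
    then show ?thesis using abs_ge_zero[of "f x * g x"] by linarith
  qed
  then show "AE x in M. norm (f x * g x) \<le> norm ((f x)\<^sup>2 + (g x)\<^sup>2)" by auto
qed measurable

lemma integrable_square_add:
  fixes f g :: "'a \<Rightarrow> real"
  assumes [measurable]: "f \<in> borel_measurable M" "g \<in> borel_measurable M"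
    and "integrable M (\<lambda>x. (f x)\<^sup>2)" "integrable M (\<lambda>x. (g x)\<^sup>2)"
  shows "integrable M (\<lambda>x. (f x + g x)\<^sup>2)"
  using integrable_mult_of_squares[OF assms] assms(3,4)
  by (auto simp: power2_sum mult.assoc)

lemma Cauchy_Schwarz_lebesgue_integral:
  fixes f g :: "'a \<Rightarrow> real"
  assumes [measurable]: "f \<in> borel_measurable M" "g \<in> borel_measurable M"
    and f2: "integrable M (\<lambda>x. (f x)\<^sup>2)" and g2: "integrable M (\<lambda>x. (g x)\<^sup>2)"
  shows "(LINT x|M. f x * g x)\<^sup>2 \<le> (LINT x|M. (f x)\<^sup>2) * (LINT x|M. (g x)\<^sup>2)"
proof -
  define a b c where "a = (LINT x|M. (f x)\<^sup>2)" and "b = (LINT x|M. f x * g x)"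
    and "c = (LINT x|M. (g x)\<^sup>2)"
  have fg: "integrable M (\<lambda>x. f x * g x)" by (rule integrable_mult_of_squares) fact+
  (* The discriminant of the nonnegative quadratic polynomial below is nonpositive. *)
  have quad: "0 \<le> a - 2 * t * b + t\<^sup>2 * c" for t
  proof -
    have "0 \<le> (LINT x|M. (f x - t * g x)\<^sup>2)" by simp
    also have "\<dots> = (LINT x|M. (f x)\<^sup>2 - 2 * t * (f x * g x) + t\<^sup>2 * (g x)\<^sup>2)"
      by (rule Bochner_Integration.integral_cong) (auto simp: power2_eq_square algebra_simps)
    also have "\<dots> = a - 2 * t * b + t\<^sup>2 * c" using f2 g2 fg by (simp add: a_def b_def c_def)
    finally show ?thesis .
  qed
  have "c \<ge> 0" by (simp add: c_def)
  have "b\<^sup>2 \<le> a * c"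
  proof (cases "c = 0")
    case True
    then have "b = 0" using quad[of "(a + 1) / (2 * b)"] by (cases "b = 0") auto
    then show ?thesis using True by simp
  next
    case False
    with \<open>c \<ge> 0\<close> have "c > 0" by simp
    then show ?thesis using quad[of "b / c"] by (simp add: field_simps power2_eq_square)
  qed
  then show ?thesis by (simp add: a_def b_def c_def)
qed

lemma Minkowski_lebesgue_integral:
  fixes f g :: "'a \<Rightarrow> real"
  assumes [measurable]: "f \<in> borel_measurable M" "g \<in> borel_measurable M"
    and f2: "integrable M (\<lambda>x. (f x)\<^sup>2)" and g2: "integrable M (\<lambda>x. (g x)\<^sup>2)"
  shows "sqrt (LINT x|M. (f x + g x)\<^sup>2) \<le> sqrt (LINT x|M. (f x)\<^sup>2) + sqrt (LINT x|M. (g x)\<^sup>2)"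
proof (rule real_le_lsqrt)
  have fg: "integrable M (\<lambda>x. f x * g x)" by (rule integrable_mult_of_squares) fact+
  have "\<bar>LINT x|M. f x * g x\<bar> \<le> sqrt ((LINT x|M. (f x)\<^sup>2) * (LINT x|M. (g x)\<^sup>2))"
    by (rule real_le_rsqrt) (simp add: Cauchy_Schwarz_lebesgue_integral assms)
  moreover have "(LINT x|M. (f x + g x)\<^sup>2)
      = (LINT x|M. (f x)\<^sup>2) + (LINT x|M. (g x)\<^sup>2) + 2 * (LINT x|M. f x * g x)"
    using f2 g2 fg by (simp add: power2_sum mult.assoc)
  ultimately show "(LINT x|M. (f x + g x)\<^sup>2)
      \<le> (sqrt (LINT x|M. (f x)\<^sup>2) + sqrt (LINT x|M. (g x)\<^sup>2))\<^sup>2"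
    by (simp add: power2_sum real_sqrt_mult)
qed auto

lemma (in pair_sigma_finite) has_bochner_integral_pair_mult:
  fixes f :: "'a \<Rightarrow> real" and g :: "'b \<Rightarrow> real"
  assumes f: "integrable M1 f" and g: "integrable M2 g"
  shows "has_bochner_integral (M1 \<Otimes>\<^sub>M M2) (\<lambda>(x, y). f x * g y)
           (integral\<^sup>L M1 f * integral\<^sup>L M2 g)"
proof -
  have [measurable]: "f \<in> borel_measurable M1" "g \<in> borel_measurable M2" using f g by auto
  have int: "integrable (M1 \<Otimes>\<^sub>M M2) (\<lambda>(x, y). f x * g y)"
    by (rule Fubini_integrable) (use f g in \<open>auto simp: abs_mult\<close>)
  have "(LINT x|M1. LINT y|M2. f x * g y) = (LINT (x, y)|(M1 \<Otimes>\<^sub>M M2). f x * g y)"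
    using integral_fst[of "\<lambda>x y. f x * g y"] int by simp
  then show ?thesis using int by (simp add: has_bochner_integral_iff)
qed

text \<open>
  A conditional expectation preserves the integral, so an almost sure bound on it bounds the
  integral itself.
\<close>

lemma (in prob_space) integrable_if_nn_cond_exp_bounded:
  fixes f :: "'a \<Rightarrow> real"
  assumes X: "X \<in> measurable M N" and f[measurable]: "f \<in> borel_measurable M" and nn: "\<And>x. f x \<ge> 0"
    and bound: "AE x in M. nn_cond_exp M (vimage_algebra (space M) X N) (\<lambda>x. ennreal (f x)) x \<le> ennreal c"
  shows "integrable M f"
proof -
  let ?F = "vimage_algebra (space M) X N"
  have "subalgebra M ?F"
    using X by (simp add: subalgebra_def measurable_iff_sets)
  then interpret finite_measure_subalgebra M ?F
    by unfold_locales
  have "(\<integral>\<^sup>+x. ennreal (f x) \<partial>M) = (\<integral>\<^sup>+x. nn_cond_exp M ?F (\<lambda>x. ennreal (f x)) x \<partial>M)"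
    using nn_cond_exp_intg[of "\<lambda>_. 1" "\<lambda>x. ennreal (f x)"] by simp
  also have "\<dots> \<le> (\<integral>\<^sup>+x. ennreal c \<partial>M)" by (rule nn_integral_mono_AE[OF bound])
  also have "\<dots> < \<infinity>" by (simp add: emeasure_space_1)
  finally show ?thesis using nn by (intro integrableI_nonneg) auto
qed

section \<open>Product experiments with bounded Kullback--Leibler divergence\<close>

text \<open>
  The log-density has mean at most \<open>\<kappa>\<close> under \<open>P\<close>, and its negative part has mean at most one because
  $-r \log r \le 1$; Markov's inequality for the positive part gives the bound on the upper tail.
\<close>

lemma KL_dist_tail:
  assumes "prob_space P" "prob_space Q" and sets: "sets P = sets Q"
    and KL: "KL_dist P Q \<le> ereal \<kappa>" and u: "u > 0"
  shows "\<exists>f\<in>borel_measurable Q. P = density Q f \<and>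
           measure P {x \<in> space Q. f x > ennreal (exp u)} \<le> (\<kappa> + 1) / u"
proof -
  interpret P: prob_space P by fact
  interpret Q: prob_space Q by fact
  define f where "f = RN_deriv Q P"
  define g where "g = entropy_density (exp 1) Q P"
  have g_eq: "g x = ln (enn2real (f x))" for x
    by (simp add: g_def f_def entropy_density_def log_def)
  have f[measurable]: "f \<in> borel_measurable Q" by (simp add: f_def)
  have [measurable_cong]: "sets P = sets Q" by fact
  have g[measurable]: "g \<in> borel_measurable Q" unfolding g_def by simp
  have sp: "space P = space Q" using sets by (rule sets_eq_imp_space_eq)
  have ac: "absolutely_continuous Q P" and int: "integrable P g"
    and le: "(LINT x|P. g x) \<le> \<kappa>"
    using KL by (auto simp: KL_dist_def KL_divergence_def g_def split: if_splits)
  have dens: "P = density Q f"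
    unfolding f_def using Q.density_RN_deriv[OF ac sets] by simp
  have fin: "AE x in Q. f x \<noteq> \<infinity>"
    unfolding f_def by (rule Q.RN_deriv_finite) (use ac sets P.sigma_finite_measure_axioms in auto)
  have finP: "AE x in P. f x \<noteq> \<infinity>"
    using absolutely_continuous_AE[OF sets ac fin] .
  have xlnx: "r * max 0 (- ln r) \<le> 1" if "r \<ge> 0" for r :: real
  proof (cases "r = 0")
    case False
    with that have "r > 0" by simp
    then have "- ln r \<le> 1 / r - 1" using ln_le_minus_one[of "1 / r"] by (simp add: ln_div)
    then have "r * (- ln r) \<le> 1" using \<open>r > 0\<close>
      using mult_left_mono[of "- ln r" "1 / r - 1" r] by (simp add: algebra_simps)
    then show ?thesis by (simp add: max_def)
  qed simp
  (* Change of measure turns the negative part of the log-density into $-r\log r$. *)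
  have neg: "(\<integral>\<^sup>+x. ennreal (max 0 (- g x)) \<partial>P) \<le> 1"
  proof -
    have "(\<integral>\<^sup>+x. ennreal (max 0 (- g x)) \<partial>P) = (\<integral>\<^sup>+x. f x * ennreal (max 0 (- g x)) \<partial>Q)"
      unfolding dens by (rule nn_integral_density) measurable
    also have "\<dots> \<le> (\<integral>\<^sup>+x. 1 \<partial>Q)"
    proof (rule nn_integral_mono_AE, use fin in eventually_elim)
      fix x assume "f x \<noteq> \<infinity>"
      then obtain r where r: "f x = ennreal r" "r \<ge> 0" by (cases "f x") auto
      have "f x * ennreal (max 0 (- g x)) = ennreal (r * max 0 (- ln r))"
        using r by (subst ennreal_mult) (auto simp: g_eq)
      also have "\<dots> \<le> 1" using xlnx[OF r(2)] unfolding ennreal_le_1 .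
      finally show "f x * ennreal (max 0 (- g x)) \<le> 1" .
    qed
    finally show ?thesis using Q.emeasure_space_1 by simp
  qed
  have int_neg: "integrable P (\<lambda>x. max 0 (- g x))" using int by simp
  have "ennreal (LINT x|P. max 0 (- g x)) \<le> 1"
    using neg by (subst nn_integral_eq_integral[symmetric]) (use int_neg in auto)
  then have neg': "(LINT x|P. max 0 (- g x)) \<le> 1" by (simp add: ennreal_le_1)
  have "(LINT x|P. max 0 (g x)) = (LINT x|P. g x + max 0 (- g x))"
    by (rule Bochner_Integration.integral_cong) auto
  also have "\<dots> \<le> \<kappa> + 1" using le neg' int int_neg by simp
  finally have pos: "(LINT x|P. max 0 (g x)) \<le> \<kappa> + 1" .
  have "measure P {x \<in> space Q. f x > ennreal (exp u)} \<le> measure P {x \<in> space P. max 0 (g x) \<ge> u}"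
  proof (rule P.finite_measure_mono_AE)
    show "AE x in P. x \<in> {x \<in> space Q. f x > ennreal (exp u)} \<longrightarrow> x \<in> {x \<in> space P. max 0 (g x) \<ge> u}"
      using finP
    proof eventually_elim
      case (elim x)
      then obtain r where r: "f x = ennreal r" "r \<ge> 0" by (cases "f x") auto
      have "u \<le> ln r" if "exp u < r" using that exp_gt_zero[of u]
        by (meson less_eq_real_def less_trans ln_ge_iff)
      then show ?case using r by (auto simp: g_eq sp ennreal_less_iff)
    qed
    show "{x \<in> space P. max 0 (g x) \<ge> u} \<in> sets P" by measurable
  qed
  also have "\<dots> \<le> (LINT x|P. max 0 (g x)) / u"
    by (rule integral_Markov_inequality_measure[where A="{}"]) (use int u in auto)
  also have "\<dots> \<le> (\<kappa> + 1) / u" using pos u by (simp add: divide_right_mono)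
  finally show ?thesis using dens f by blast
qed

lemma PiM_density_eq:
  assumes "finite I" "prob_space Q" "prob_space (density Q f)" and [measurable]: "f \<in> borel_measurable Q"
  shows "(\<Pi>\<^sub>M i\<in>I. density Q f) = density (\<Pi>\<^sub>M i\<in>I. Q) (\<lambda>x. \<Prod>i\<in>I. f (x i))"
proof (rule sym, rule product_sigma_finite.PiM_eqI)
  interpret Q: prob_space Q by fact
  interpret P: prob_space "density Q f" by fact
  interpret PP: product_prob_space "\<lambda>i. density Q f" by unfold_locales
  interpret QQ: product_prob_space "\<lambda>i. Q" by unfold_locales
  show "product_sigma_finite (\<lambda>i. density Q f)" ..
  show "finite I" by fact
  show "sets (density (Pi\<^sub>M I (\<lambda>i. Q)) (\<lambda>x. \<Prod>i\<in>I. f (x i))) = sets (\<Pi>\<^sub>M i\<in>I. density Q f)"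
    by (simp cong: sets_PiM_cong)
  fix A assume A: "\<And>i. i \<in> I \<Longrightarrow> A i \<in> sets (density Q f)"
  then have A': "\<And>i. i \<in> I \<Longrightarrow> A i \<in> sets Q" by simp
  have "emeasure (density (Pi\<^sub>M I (\<lambda>i. Q)) (\<lambda>x. \<Prod>i\<in>I. f (x i))) (Pi\<^sub>E I A)
      = (\<integral>\<^sup>+x. (\<Prod>i\<in>I. f (x i)) * indicator (Pi\<^sub>E I A) x \<partial>Pi\<^sub>M I (\<lambda>i. Q))"
    using A' \<open>finite I\<close> by (intro emeasure_density) (auto intro: sets_PiM_I_finite)
  also have "\<dots> = (\<integral>\<^sup>+x. (\<Prod>i\<in>I. f (x i) * indicator (A i) (x i)) \<partial>Pi\<^sub>M I (\<lambda>i. Q))"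
  proof (rule nn_integral_cong)
    fix x assume x: "x \<in> space (Pi\<^sub>M I (\<lambda>i. Q))"
    show "(\<Prod>i\<in>I. f (x i)) * indicator (Pi\<^sub>E I A) x = (\<Prod>i\<in>I. f (x i) * indicator (A i) (x i))"
    proof (cases "x \<in> Pi\<^sub>E I A")
      case True
      then have "\<And>i. i \<in> I \<Longrightarrow> x i \<in> A i" by auto
      then show ?thesis using True by (auto intro!: prod.cong simp: indicator_def)
    next
      case False
      then obtain i where "i \<in> I" "x i \<notin> A i" using x by (auto simp: space_PiM PiE_def Pi_def)
      then show ?thesis using False \<open>finite I\<close> by (auto intro!: prod_zero[symmetric] bexI[of _ i])
    qed
  qed
  also have "\<dots> = (\<Prod>i\<in>I. \<integral>\<^sup>+x. f x * indicator (A i) x \<partial>Q)"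
    using A' \<open>finite I\<close> by (intro QQ.product_nn_integral_prod) auto
  also have "\<dots> = (\<Prod>i\<in>I. emeasure (density Q f) (A i))"
    using A' by (intro prod.cong) (auto simp: emeasure_density)
  finally show "emeasure (density (Pi\<^sub>M I (\<lambda>i. Q)) (\<lambda>x. \<Prod>i\<in>I. f (x i))) (Pi\<^sub>E I A)
      = (\<Prod>i\<in>I. emeasure (density Q f) (A i))" .
qed

text \<open>
  Where all the factors \<open>f (x i)\<close> are at most \<open>l\<close>, the product density is at most \<open>l ^ card I\<close>; a union
  bound disposes of the rest. This replaces the additivity of the divergence over product measures.
\<close>

lemma PiM_density_bound:
  assumes I: "finite I" and PQ: "prob_space Q" "prob_space (density Q f)"
    and f[measurable]: "f \<in> borel_measurable Q"
    and A: "A \<in> sets (\<Pi>\<^sub>M i\<in>I. Q)" and l: "l \<ge> 0"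
  shows "measure (\<Pi>\<^sub>M i\<in>I. density Q f) A \<le>
           l ^ card I * measure (\<Pi>\<^sub>M i\<in>I. Q) A
           + card I * measure (density Q f) {x \<in> space Q. f x > ennreal l}"
proof -
  interpret Q: prob_space Q by fact
  interpret P: prob_space "density Q f" by fact
  interpret PP': prob_space "\<Pi>\<^sub>M i\<in>I. density Q f" by (rule prob_space_PiM) (rule PQ)
  interpret QQ': prob_space "\<Pi>\<^sub>M i\<in>I. Q" by (rule prob_space_PiM) (rule Q.prob_space_axioms)
  have sets_eq[measurable_cong]: "sets (\<Pi>\<^sub>M i\<in>I. density Q f) = sets (\<Pi>\<^sub>M i\<in>I. Q)"
    by (simp cong: sets_PiM_cong)
  have space_eq: "space (\<Pi>\<^sub>M i\<in>I. density Q f) = space (\<Pi>\<^sub>M i\<in>I. Q)"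
    using sets_eq by (rule sets_eq_imp_space_eq)
  have [measurable]: "A \<in> sets (\<Pi>\<^sub>M i\<in>I. Q)" by fact
  define B where "B = {x \<in> space Q. f x > ennreal l}"
  have B[measurable]: "B \<in> sets Q" unfolding B_def by measurable
  define C where "C i = {x \<in> space (\<Pi>\<^sub>M i\<in>I. Q). x i \<in> B}" for i
  have C: "C i \<in> sets (\<Pi>\<^sub>M i\<in>I. Q)" if "i \<in> I" for i
    unfolding C_def using that by measurable
  have PC: "measure (\<Pi>\<^sub>M i\<in>I. density Q f) (C i) = measure (density Q f) B" if "i \<in> I" for i
  proof -
    have "measure (density Q f) B = measure (distr (\<Pi>\<^sub>M i\<in>I. density Q f) (density Q f) (\<lambda>\<omega>. \<omega> i)) B"
      using distr_PiM_component[of I "\<lambda>_. density Q f" i] that PQ by simp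
    also have "\<dots> = measure (\<Pi>\<^sub>M i\<in>I. density Q f) (C i)"
      using that by (subst measure_distr) (auto simp: C_def space_eq intro!: arg_cong2[where f=measure])
    finally show ?thesis by simp
  qed
  define G where "G = A - (\<Union>i\<in>I. C i)"
  have UC: "(\<Union>i\<in>I. C i) \<in> sets (\<Pi>\<^sub>M i\<in>I. Q)" using C I by (intro sets.finite_UN) auto
  have G[measurable]: "G \<in> sets (\<Pi>\<^sub>M i\<in>I. Q)" unfolding G_def using A UC by (rule sets.Diff)
  have "emeasure (\<Pi>\<^sub>M i\<in>I. density Q f) G
      = (\<integral>\<^sup>+x. (\<Prod>i\<in>I. f (x i)) * indicator G x \<partial>Pi\<^sub>M I (\<lambda>i. Q))"
    unfolding PiM_density_eq[OF I PQ f] by (rule emeasure_density) measurable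
  also have "\<dots> \<le> (\<integral>\<^sup>+x. ennreal (l ^ card I) * indicator G x \<partial>Pi\<^sub>M I (\<lambda>i. Q))"
  proof (rule nn_integral_mono)
    fix x assume x: "x \<in> space (Pi\<^sub>M I (\<lambda>i. Q))"
    have "(\<Prod>i\<in>I. f (x i)) \<le> (\<Prod>i\<in>I. ennreal l)" if "x \<in> G"
      using that x by (intro prod_mono_ennreal) (auto simp: G_def C_def B_def space_PiM not_less)
    then show "(\<Prod>i\<in>I. f (x i)) * indicator G x \<le> ennreal (l ^ card I) * indicator G x"
      using l by (auto simp: indicator_def ennreal_power)
  qed
  also have "\<dots> = ennreal (l ^ card I) * emeasure (\<Pi>\<^sub>M i\<in>I. Q) G"
    by (simp add: nn_integral_cmult_indicator)
  also have "\<dots> \<le> ennreal (l ^ card I) * emeasure (\<Pi>\<^sub>M i\<in>I. Q) A"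
    by (intro mult_left_mono emeasure_mono) (auto simp: G_def)
  finally have "measure (\<Pi>\<^sub>M i\<in>I. density Q f) G \<le> l ^ card I * measure (\<Pi>\<^sub>M i\<in>I. Q) A"
    using l by (simp add: PP'.emeasure_eq_measure QQ'.emeasure_eq_measure ennreal_mult[symmetric])
  moreover have "measure (\<Pi>\<^sub>M i\<in>I. density Q f) A \<le> measure (\<Pi>\<^sub>M i\<in>I. density Q f) (G \<union> (\<Union>i\<in>I. C i))"
    using G UC sets_eq by (intro PP'.finite_measure_mono) (auto simp: G_def)
  moreover have "\<dots> \<le> measure (\<Pi>\<^sub>M i\<in>I. density Q f) G + measure (\<Pi>\<^sub>M i\<in>I. density Q f) (\<Union>i\<in>I. C i)"
    using G UC sets_eq by (intro measure_Un_le) auto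
  moreover have "measure (\<Pi>\<^sub>M i\<in>I. density Q f) (\<Union>i\<in>I. C i) \<le> (\<Sum>i\<in>I. measure (\<Pi>\<^sub>M i\<in>I. density Q f) (C i))"
    using I C sets_eq by (intro measure_UNION_le) auto
  moreover have "\<dots> = card I * measure (density Q f) B" using PC by simp
  ultimately show ?thesis by (simp add: B_def)
qed

text \<open>
  The disjoint events have total mass at most one under the product of \<open>Q\<close>, so most of them have
  arbitrarily small mass when there are many. Up to a small error, the product of \<open>P j\<close> exceeds the
  product of \<open>Q\<close> by at most a factor that depends on \<open>\<kappa>\<close>, \<open>card I\<close> and \<open>\<eta>\<close>, but not on \<open>j\<close>.
\<close>

lemma disjoint_events_bounded_KL:
  fixes P :: "'j \<Rightarrow> 'a measure"
  assumes I: "finite I" and Q: "prob_space Q"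
    and inf: "infinite J" and P: "\<And>j. j \<in> J \<Longrightarrow> prob_space (P j)"
    and sets: "\<And>j. j \<in> J \<Longrightarrow> sets (P j) = sets Q"
    and KL: "\<And>j. j \<in> J \<Longrightarrow> KL_dist (P j) Q \<le> ereal \<kappa>"
    and A: "\<And>j. j \<in> J \<Longrightarrow> A j \<in> sets (\<Pi>\<^sub>M i\<in>I. Q)" and disj: "disjoint_family_on A J"
    and \<eta>: "\<eta> > 0"
  shows "\<exists>j\<in>J. measure (\<Pi>\<^sub>M i\<in>I. P j) (A j) < \<eta>"
proof -
  interpret Q: prob_space Q by fact
  interpret QQ: prob_space "\<Pi>\<^sub>M i\<in>I. Q" by (rule prob_space_PiM) (rule Q.prob_space_axioms)
  define n where "n = card I"
  (* The tail bound of \<open>KL_dist_tail\<close>, summed over the sample, is then less than \<open>\<eta> / 2\<close>. *)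
  define u where "u = 2 * (n * (\<bar>\<kappa>\<bar> + 1) + 1) / \<eta>"
  have "n * (\<bar>\<kappa>\<bar> + 1) \<ge> 0" by simp
  then have "n * (\<bar>\<kappa>\<bar> + 1) + 1 > 0" by linarith
  then have u: "u > 0" unfolding u_def using \<eta> by (intro divide_pos_pos mult_pos_pos) auto
  have "n * (\<bar>\<kappa>\<bar> + 1) / u \<le> \<eta> / 2 * (n * (\<bar>\<kappa>\<bar> + 1) / (n * (\<bar>\<kappa>\<bar> + 1) + 1))"
    by (simp add: u_def mult.commute)
  also have "\<dots> < \<eta> / 2 * 1" using \<eta> \<open>n * (\<bar>\<kappa>\<bar> + 1) \<ge> 0\<close> by (intro mult_strict_left_mono) (simp_all add: divide_less_eq not_less)
  finally have small: "n * (\<bar>\<kappa>\<bar> + 1) / u < \<eta> / 2" by simp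
  have bound: "measure (\<Pi>\<^sub>M i\<in>I. P j) (A j) \<le> exp u ^ n * measure (\<Pi>\<^sub>M i\<in>I. Q) (A j) + \<eta> / 2"
    if j: "j \<in> J" for j
  proof -
    obtain f where f: "f \<in> borel_measurable Q" "P j = density Q f"
      and tail: "measure (P j) {x \<in> space Q. f x > ennreal (exp u)} \<le> (\<kappa> + 1) / u"
      using KL_dist_tail[OF P[OF j] Q sets[OF j] KL[OF j] u] by blast
    have "measure (\<Pi>\<^sub>M i\<in>I. P j) (A j) \<le> exp u ^ n * measure (\<Pi>\<^sub>M i\<in>I. Q) (A j)
        + n * measure (P j) {x \<in> space Q. f x > ennreal (exp u)}"
      unfolding f(2) n_def
      by (rule PiM_density_bound) (use I Q P[OF j] f A[OF j] in auto)
    also have "n * measure (P j) {x \<in> space Q. f x > ennreal (exp u)} \<le> n * ((\<bar>\<kappa>\<bar> + 1) / u)"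
      using tail u by (intro mult_left_mono order.trans[OF tail] divide_right_mono) auto
    finally have "measure (\<Pi>\<^sub>M i\<in>I. P j) (A j)
        \<le> exp u ^ n * measure (\<Pi>\<^sub>M i\<in>I. Q) (A j) + n * (\<bar>\<kappa>\<bar> + 1) / u" by simp
    then show ?thesis using small by linarith
  qed
  (* With \<open>m\<close> events, the average mass under the dominating product is at most \<open>1 / m\<close>. *)
  obtain m :: nat where m: "2 * exp u ^ n / \<eta> < m" using reals_Archimedean2 by blast
  obtain F where F: "F \<subseteq> J" "finite F" "card F = m"
    using infinite_arbitrarily_large[OF inf] by blast
  have "(\<Sum>j\<in>F. measure (\<Pi>\<^sub>M i\<in>I. Q) (A j)) = measure (\<Pi>\<^sub>M i\<in>I. Q) (\<Union>j\<in>F. A j)"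
    using F A disjoint_family_on_mono[OF F(1) disj]
    by (intro QQ.finite_measure_finite_Union[symmetric]) auto
  then have total: "(\<Sum>j\<in>F. measure (\<Pi>\<^sub>M i\<in>I. Q) (A j)) \<le> 1" by simp
  show ?thesis
  proof (rule ccontr)
    assume "\<not> ?thesis"
    then have "\<eta> \<le> exp u ^ n * measure (\<Pi>\<^sub>M i\<in>I. Q) (A j) + \<eta> / 2" if "j \<in> F" for j
      using bound[of j] that F by (meson not_less order.trans subsetD)
    then have "(\<Sum>j\<in>F. \<eta>) \<le> (\<Sum>j\<in>F. exp u ^ n * measure (\<Pi>\<^sub>M i\<in>I. Q) (A j) + \<eta> / 2)"
      by (rule sum_mono)
    also have "\<dots> = exp u ^ n * (\<Sum>j\<in>F. measure (\<Pi>\<^sub>M i\<in>I. Q) (A j)) + m * (\<eta> / 2)"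
      using F by (simp add: sum.distrib sum_distrib_left)
    also have "\<dots> \<le> exp u ^ n + m * (\<eta> / 2)"
      using total by (auto intro: mult_left_le)
    finally have "m * (\<eta> / 2) \<le> exp u ^ n" using F by (simp add: field_simps)
    then show False using m \<eta> by (simp add: field_simps)
  qed
qed

section \<open>Second moments of a linear functional of a random function\<close>

text \<open>
  A random function whose sample paths are square integrable and whose second-moment kernel \<open>C\<close> is
  square integrable. The expected squared norm of a sample path need not be finite.
\<close>

locale second_order_process =
  M: prob_space M + \<mu>: finite_measure \<mu>
  for M :: "'w measure" and \<mu> :: "'t measure" +
  fixes Y :: "'w \<Rightarrow> 't \<Rightarrow> real" and C :: "'t \<Rightarrow> 't \<Rightarrow> real"
  assumes Y[measurable]: "case_prod Y \<in> borel_measurable (M \<Otimes>\<^sub>M \<mu>)"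
    and Y_sq: "\<And>\<omega>. \<omega> \<in> space M \<Longrightarrow> integrable \<mu> (\<lambda>t. (Y \<omega> t)\<^sup>2)"
    and fin: "AE t in \<mu>. integrable M (\<lambda>\<omega>. (Y \<omega> t)\<^sup>2)"
    and C: "\<And>s t. C s t = (LINT \<omega>|M. Y \<omega> s * Y \<omega> t)"
    and C_meas[measurable]: "case_prod C \<in> borel_measurable (\<mu> \<Otimes>\<^sub>M \<mu>)"
    and C_sq: "integrable (\<mu> \<Otimes>\<^sub>M \<mu>) (\<lambda>(s, t). (C s t)\<^sup>2)"
begin

sublocale M\<mu>: pair_sigma_finite M \<mu> ..
sublocale \<mu>\<mu>: pair_sigma_finite \<mu> \<mu> ..

abbreviation pairing :: "('t \<Rightarrow> real) \<Rightarrow> 'w \<Rightarrow> real" where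
  "pairing b \<omega> \<equiv> LINT t|\<mu>. Y \<omega> t * b t"

lemma C_mult_integrable:
  assumes [measurable]: "b \<in> borel_measurable \<mu>" "b' \<in> borel_measurable \<mu>"
    and b: "integrable \<mu> (\<lambda>t. (b t)\<^sup>2)" and b': "integrable \<mu> (\<lambda>t. (b' t)\<^sup>2)"
  shows "integrable (\<mu> \<Otimes>\<^sub>M \<mu>) (\<lambda>(s, t). C s t * (b s * b' t))"
proof -
  have "integrable (\<mu> \<Otimes>\<^sub>M \<mu>) (\<lambda>z. (case z of (s, t) \<Rightarrow> C s t) * (case z of (s, t) \<Rightarrow> b s * b' t))"
  proof (rule integrable_mult_of_squares)
    have "integrable (\<mu> \<Otimes>\<^sub>M \<mu>) (\<lambda>(s, t). (b s)\<^sup>2 * (b' t)\<^sup>2)"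
      using \<mu>\<mu>.has_bochner_integral_pair_mult[OF b b'] by (simp add: has_bochner_integral_iff)
    then show "integrable (\<mu> \<Otimes>\<^sub>M \<mu>) (\<lambda>z. (case z of (s, t) \<Rightarrow> b s * b' t)\<^sup>2)"
      by (simp add: power_mult_distrib split_beta')
    show "integrable (\<mu> \<Otimes>\<^sub>M \<mu>) (\<lambda>z. (case z of (s, t) \<Rightarrow> C s t)\<^sup>2)"
      using C_sq by (simp add: split_beta')
  qed measurable
  then show ?thesis by (simp add: split_beta')
qed

definition pointwise_second_moment :: "'t \<Rightarrow> ennreal" where
  "pointwise_second_moment t = (\<integral>\<^sup>+\<omega>. ennreal ((Y \<omega> t)\<^sup>2) \<partial>M)"

lemma pointwise_second_moment_measurable[measurable]: "pointwise_second_moment \<in> borel_measurable \<mu>"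
  unfolding pointwise_second_moment_def by measurable

lemma pointwise_second_moment_finite: "AE t in \<mu>. pointwise_second_moment t < \<infinity>"
  using fin
proof eventually_elim
  case (elim t)
  then show ?case by (simp add: pointwise_second_moment_def nn_integral_eq_integral)
qed

lemma pairing_measurable[measurable]:
  assumes [measurable]: "b \<in> borel_measurable \<mu>"
  shows "pairing b \<in> borel_measurable M"
  by measurable

lemma Y_mult_integrable:
  assumes [measurable]: "b \<in> borel_measurable \<mu>" and b: "integrable \<mu> (\<lambda>t. (b t)\<^sup>2)"
    and \<omega>: "\<omega> \<in> space M"
  shows "integrable \<mu> (\<lambda>t. Y \<omega> t * b t)"
proof (rule integrable_mult_of_squares)
  show "(\<lambda>t. Y \<omega> t) \<in> borel_measurable \<mu>" using \<omega> by measurable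
qed (use b Y_sq[OF \<omega>] in auto)

lemma pairing_diff:
  assumes "b \<in> borel_measurable \<mu>" "integrable \<mu> (\<lambda>t. (b t)\<^sup>2)"
    and "b' \<in> borel_measurable \<mu>" "integrable \<mu> (\<lambda>t. (b' t)\<^sup>2)" and "\<omega> \<in> space M"
  shows "pairing (\<lambda>t. b t - b' t) \<omega> = pairing b \<omega> - pairing b' \<omega>"
  using Y_mult_integrable[of b \<omega>] Y_mult_integrable[of b' \<omega>] assms by (simp add: right_diff_distrib)

text \<open>
  If \<open>b\<close> vanishes where the pointwise second moment exceeds \<open>m\<close>, then
  $|Y(s)Y(t)b(s)b(t)|$ has mean at most $2m\,|b(s)b(t)|$, which is integrable over \<open>s\<close> and \<open>t\<close>, and
  Fubini's theorem applies.
\<close>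

lemma pairing_second_moment_bounded:
  assumes [measurable]: "b \<in> borel_measurable \<mu>" and b: "integrable \<mu> (\<lambda>t. (b t)\<^sup>2)"
    and m: "\<And>t. t \<in> space \<mu> \<Longrightarrow> b t \<noteq> 0 \<Longrightarrow> pointwise_second_moment t \<le> ennreal m"
  shows "has_bochner_integral M (\<lambda>\<omega>. (pairing b \<omega>)\<^sup>2) (LINT (s, t)|(\<mu> \<Otimes>\<^sub>M \<mu>). C s t * (b s * b t))"
proof -
  interpret N: pair_sigma_finite M "\<mu> \<Otimes>\<^sub>M \<mu>" ..
  define G where "G = (\<lambda>\<omega> z. Y \<omega> (fst z) * Y \<omega> (snd z) * (b (fst z) * b (snd z)))"
  have [measurable]: "case_prod G \<in> borel_measurable (M \<Otimes>\<^sub>M (\<mu> \<Otimes>\<^sub>M \<mu>))"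
    unfolding G_def by measurable
  have bint: "integrable \<mu> b" by (rule \<mu>.square_integrable_imp_integrable) fact+
  have inner: "(\<integral>\<^sup>+\<omega>. ennreal \<bar>G \<omega> z\<bar> \<partial>M) \<le> ennreal (2 * \<bar>m\<bar> * (\<bar>b (fst z)\<bar> * \<bar>b (snd z)\<bar>))"
    if z: "z \<in> space (\<mu> \<Otimes>\<^sub>M \<mu>)" for z
  proof (cases "b (fst z) * b (snd z) = 0")
    case False
    obtain s t where st: "z = (s, t)" by (cases z)
    have sp: "s \<in> space \<mu>" "t \<in> space \<mu>" using z st by (auto simp: space_pair_measure)
    note [measurable] = sp
    have ab: "\<bar>x * y\<bar> \<le> x\<^sup>2 + y\<^sup>2" for x y :: real
    proof -
      have "2 * \<bar>x * y\<bar> \<le> x\<^sup>2 + y\<^sup>2"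
        using sum_squares_bound[of "\<bar>x\<bar>" "\<bar>y\<bar>"] by (simp add: abs_mult)
      then show ?thesis using abs_ge_zero[of "x * y"] by linarith
    qed
    have "(\<integral>\<^sup>+\<omega>. ennreal \<bar>G \<omega> z\<bar> \<partial>M)
        \<le> (\<integral>\<^sup>+\<omega>. ennreal (\<bar>b s\<bar> * \<bar>b t\<bar>) * (ennreal ((Y \<omega> s)\<^sup>2) + ennreal ((Y \<omega> t)\<^sup>2)) \<partial>M)"
    proof (rule nn_integral_mono)
      fix \<omega>
      have "\<bar>G \<omega> z\<bar> = \<bar>b s\<bar> * \<bar>b t\<bar> * \<bar>Y \<omega> s * Y \<omega> t\<bar>"
        by (simp add: G_def st abs_mult mult_ac)
      also have "\<dots> \<le> \<bar>b s\<bar> * \<bar>b t\<bar> * ((Y \<omega> s)\<^sup>2 + (Y \<omega> t)\<^sup>2)"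
        by (intro mult_left_mono ab) auto
      finally show "ennreal \<bar>G \<omega> z\<bar>
          \<le> ennreal (\<bar>b s\<bar> * \<bar>b t\<bar>) * (ennreal ((Y \<omega> s)\<^sup>2) + ennreal ((Y \<omega> t)\<^sup>2))"
        by (simp add: ennreal_mult[symmetric] ennreal_plus[symmetric] ennreal_leI del: ennreal_plus)
    qed
    also have "\<dots> = ennreal (\<bar>b s\<bar> * \<bar>b t\<bar>) * (pointwise_second_moment s + pointwise_second_moment t)"
      by (simp add: nn_integral_cmult nn_integral_add pointwise_second_moment_def)
    also have "\<dots> \<le> ennreal (\<bar>b s\<bar> * \<bar>b t\<bar>) * (ennreal \<bar>m\<bar> + ennreal \<bar>m\<bar>)"
    proof (intro mult_left_mono add_mono)
      have "ennreal m \<le> ennreal \<bar>m\<bar>" by (rule ennreal_leI) simp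
      then show "pointwise_second_moment s \<le> ennreal \<bar>m\<bar>" "pointwise_second_moment t \<le> ennreal \<bar>m\<bar>"
        using m[of s] m[of t] sp False st by (auto intro: order.trans)
    qed auto
    also have "\<dots> = ennreal (2 * \<bar>m\<bar> * (\<bar>b (fst z)\<bar> * \<bar>b (snd z)\<bar>))"
      by (simp add: st ennreal_mult[symmetric] ennreal_plus[symmetric] mult_ac del: ennreal_plus)
    finally show ?thesis .
  qed (auto simp: G_def)
  have "integrable (M \<Otimes>\<^sub>M (\<mu> \<Otimes>\<^sub>M \<mu>)) (case_prod G)"
  proof (rule integrableI_bounded)
    have "(\<integral>\<^sup>+x. norm (case_prod G x) \<partial>(M \<Otimes>\<^sub>M (\<mu> \<Otimes>\<^sub>M \<mu>)))
        = (\<integral>\<^sup>+z. (\<integral>\<^sup>+\<omega>. ennreal \<bar>G \<omega> z\<bar> \<partial>M) \<partial>(\<mu> \<Otimes>\<^sub>M \<mu>))"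
      by (subst N.nn_integral_snd[symmetric]) auto
    also have "\<dots> \<le> (\<integral>\<^sup>+z. ennreal (2 * \<bar>m\<bar> * (\<bar>b (fst z)\<bar> * \<bar>b (snd z)\<bar>)) \<partial>(\<mu> \<Otimes>\<^sub>M \<mu>))"
      by (rule nn_integral_mono) (rule inner)
    also have "\<dots> < \<infinity>"
    proof -
      have "integrable (\<mu> \<Otimes>\<^sub>M \<mu>) (\<lambda>(s, t). \<bar>b s\<bar> * \<bar>b t\<bar>)"
        using \<mu>\<mu>.has_bochner_integral_pair_mult[of "\<lambda>s. \<bar>b s\<bar>" "\<lambda>s. \<bar>b s\<bar>"] bint
        by (simp add: has_bochner_integral_iff)
      then have "integrable (\<mu> \<Otimes>\<^sub>M \<mu>) (\<lambda>z. 2 * \<bar>m\<bar> * (\<bar>b (fst z)\<bar> * \<bar>b (snd z)\<bar>))"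
        by (intro integrable_mult_right) (simp add: split_beta')
      then show ?thesis by (subst nn_integral_eq_integral) auto
    qed
    finally show "(\<integral>\<^sup>+x. norm (case_prod G x) \<partial>(M \<Otimes>\<^sub>M (\<mu> \<Otimes>\<^sub>M \<mu>))) < \<infinity>" .
  qed measurable
  note Gint = this
  have sq: "(LINT z|(\<mu> \<Otimes>\<^sub>M \<mu>). G \<omega> z) = (pairing b \<omega>)\<^sup>2" if \<omega>: "\<omega> \<in> space M" for \<omega>
  proof -
    have "has_bochner_integral (\<mu> \<Otimes>\<^sub>M \<mu>) (\<lambda>(s, t). (Y \<omega> s * b s) * (Y \<omega> t * b t))
        (pairing b \<omega> * pairing b \<omega>)"
      by (rule \<mu>\<mu>.has_bochner_integral_pair_mult) (use Y_mult_integrable[of b \<omega>] b \<omega> in auto)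
    then show ?thesis
      by (simp add: has_bochner_integral_iff G_def split_beta' power2_eq_square mult_ac)
  qed
  have "integrable M (\<lambda>\<omega>. LINT z|(\<mu> \<Otimes>\<^sub>M \<mu>). G \<omega> z)"
    using N.integrable_fst[of G] Gint by simp
  then have int: "integrable M (\<lambda>\<omega>. (pairing b \<omega>)\<^sup>2)"
    by (rule Bochner_Integration.integrable_cong[THEN iffD1, rotated 2]) (auto simp: sq)
  have "(LINT \<omega>|M. (pairing b \<omega>)\<^sup>2) = (LINT \<omega>|M. LINT z|(\<mu> \<Otimes>\<^sub>M \<mu>). G \<omega> z)"
    by (rule Bochner_Integration.integral_cong) (auto simp: sq)
  also have "\<dots> = (LINT z|(\<mu> \<Otimes>\<^sub>M \<mu>). LINT \<omega>|M. G \<omega> z)"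
    using N.Fubini_integral[of G] Gint by simp
  also have "\<dots> = (LINT (s, t)|(\<mu> \<Otimes>\<^sub>M \<mu>). C s t * (b s * b t))"
    by (simp add: G_def C split_beta')
  finally show ?thesis using int by (simp add: has_bochner_integral_iff)
qed

definition trunc :: "nat \<Rightarrow> ('t \<Rightarrow> real) \<Rightarrow> 't \<Rightarrow> real" where
  "trunc m b t = (if pointwise_second_moment t \<le> of_nat m then b t else 0)"

lemma trunc_measurable[measurable]:
  assumes [measurable]: "b \<in> borel_measurable \<mu>"
  shows "trunc m b \<in> borel_measurable \<mu>"
  unfolding trunc_def[abs_def] by measurable

lemma trunc_eventually:
  assumes "pointwise_second_moment t < \<infinity>"
  shows "eventually (\<lambda>m. trunc m b t = b t) sequentially"
proof -
  obtain m0 :: nat where "pointwise_second_moment t < of_nat m0"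
    using assms by (auto dest: ennreal_Ex_less_of_nat simp: top_unique)
  then have "pointwise_second_moment t \<le> of_nat m" if "m \<ge> m0" for m
    using that by (meson less_imp_le of_nat_mono order.trans)
  then show ?thesis by (auto simp: trunc_def eventually_sequentially)
qed

lemma AE_trunc_eventually: "AE t in \<mu>. eventually (\<lambda>m. trunc m b t = b t) sequentially"
  using pointwise_second_moment_finite trunc_eventually by (auto elim!: eventually_mono)

lemma AE_pair_second_moment_finite:
  "AE z in \<mu> \<Otimes>\<^sub>M \<mu>. pointwise_second_moment (fst z) < \<infinity> \<and> pointwise_second_moment (snd z) < \<infinity>"
proof -
  have "AE x in \<mu>. AE y in \<mu>. pointwise_second_moment x < \<infinity> \<and> pointwise_second_moment y < \<infinity>"
    using pointwise_second_moment_finite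
  proof eventually_elim
    case (elim x)
    show ?case using pointwise_second_moment_finite
      by (rule eventually_mono) (use elim in simp)
  qed
  then show ?thesis by (intro \<mu>\<mu>.AE_pair_measure) (auto simp: split_beta')
qed

lemma square_integrable_trunc:
  assumes [measurable]: "b \<in> borel_measurable \<mu>" and b: "integrable \<mu> (\<lambda>t. (b t)\<^sup>2)"
  shows "integrable \<mu> (\<lambda>t. (trunc m b t)\<^sup>2)"
    "integrable \<mu> (\<lambda>t. (b t - trunc m b t)\<^sup>2)" "integrable \<mu> (\<lambda>t. (trunc k b t - trunc m b t)\<^sup>2)"
  by (rule Bochner_Integration.integrable_bound[OF b]; auto simp: trunc_def)+

text \<open>
  A bound for the second moment of the pairing with the part of \<open>b\<close> that \<open>trunc m\<close> removes.
\<close>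

definition tail :: "('t \<Rightarrow> real) \<Rightarrow> nat \<Rightarrow> real" where
  "tail b m = (LINT (s, t)|(\<mu> \<Otimes>\<^sub>M \<mu>).
     \<bar>C s t\<bar> * (\<bar>b s - trunc m b s\<bar> * \<bar>b t - trunc m b t\<bar>))"

lemma tail_tendsto_0:
  assumes [measurable]: "b \<in> borel_measurable \<mu>" and b: "integrable \<mu> (\<lambda>t. (b t)\<^sup>2)"
  shows "tail b \<longlonglongrightarrow> 0"
proof -
  have "(\<lambda>m. LINT z|(\<mu> \<Otimes>\<^sub>M \<mu>). \<bar>C (fst z) (snd z)\<bar> *
      (\<bar>b (fst z) - trunc m b (fst z)\<bar> * \<bar>b (snd z) - trunc m b (snd z)\<bar>))
    \<longlonglongrightarrow> (LINT z|(\<mu> \<Otimes>\<^sub>M \<mu>). 0)"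
  proof (rule integral_dominated_convergence
      [where w = "\<lambda>z. \<bar>C (fst z) (snd z) * (b (fst z) * b (snd z))\<bar>"])
    show "integrable (\<mu> \<Otimes>\<^sub>M \<mu>) (\<lambda>z. \<bar>C (fst z) (snd z) * (b (fst z) * b (snd z))\<bar>)"
      using C_mult_integrable[of b b] b by (intro integrable_abs) (simp add: split_beta')
    show "AE z in \<mu> \<Otimes>\<^sub>M \<mu>. (\<lambda>m. \<bar>C (fst z) (snd z)\<bar> *
      (\<bar>b (fst z) - trunc m b (fst z)\<bar> * \<bar>b (snd z) - trunc m b (snd z)\<bar>)) \<longlonglongrightarrow> 0"
      using AE_pair_second_moment_finite
    proof eventually_elim
      case (elim z)
      then have "pointwise_second_moment (fst z) < \<infinity>" by simp
      from trunc_eventually[OF this, of b] show ?case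
        by (rule tendsto_eventually[OF eventually_mono]) simp
    qed
    show "AE z in \<mu> \<Otimes>\<^sub>M \<mu>. norm (\<bar>C (fst z) (snd z)\<bar> *
      (\<bar>b (fst z) - trunc m b (fst z)\<bar> * \<bar>b (snd z) - trunc m b (snd z)\<bar>))
      \<le> \<bar>C (fst z) (snd z) * (b (fst z) * b (snd z))\<bar>" for m
      by (auto simp: trunc_def abs_mult)
  qed auto
  then show ?thesis by (simp add: tail_def[abs_def] split_beta')
qed

text \<open>
  The difference of two truncations is bounded in the sense of \<open>pairing_second_moment_bounded\<close>, and
  its second moment is at most the tail integral. Fatou's lemma transfers this bound to the limit,
  so that the limit is square integrable as well.
\<close>

lemma pairing_tail:
  assumes [measurable]: "b \<in> borel_measurable \<mu>" and b: "integrable \<mu> (\<lambda>t. (b t)\<^sup>2)"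
  shows "integrable M (\<lambda>\<omega>. (pairing (\<lambda>t. b t - trunc m b t) \<omega>)\<^sup>2)"
    and "(LINT \<omega>|M. (pairing (\<lambda>t. b t - trunc m b t) \<omega>)\<^sup>2) \<le> tail b m"
proof -
  let ?V = "\<lambda>k. pairing (\<lambda>t. trunc k b t - trunc m b t)" and ?W = "pairing (\<lambda>t. b t - trunc m b t)"
  have tail_int: "integrable (\<mu> \<Otimes>\<^sub>M \<mu>)
      (\<lambda>z. \<bar>C (fst z) (snd z)\<bar> * (\<bar>b (fst z) - trunc m b (fst z)\<bar> * \<bar>b (snd z) - trunc m b (snd z)\<bar>))"
    using integrable_abs[OF C_mult_integrable[of "\<lambda>t. b t - trunc m b t" "\<lambda>t. b t - trunc m b t"]]
      square_integrable_trunc[OF assms] by (simp add: split_beta' abs_mult)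
  have bound: "(\<integral>\<^sup>+\<omega>. ennreal ((?V k \<omega>)\<^sup>2) \<partial>M) \<le> ennreal (tail b m)" if k: "k \<ge> m" for k
  proof -
    have mk: "pointwise_second_moment t \<le> of_nat k" if "pointwise_second_moment t \<le> of_nat m" for t
      using that of_nat_mono[OF k, where 'a = ennreal] by (rule order.trans)
    then have "pointwise_second_moment t \<le> ennreal (real k)" if "trunc k b t - trunc m b t \<noteq> 0" for t
      using that by (cases "pointwise_second_moment t \<le> of_nat k")
        (auto simp: trunc_def ennreal_of_nat_eq_real_of_nat[symmetric] split: if_splits)
    then have V: "has_bochner_integral M (\<lambda>\<omega>. (?V k \<omega>)\<^sup>2) (LINT (s, t)|(\<mu> \<Otimes>\<^sub>M \<mu>).
        C s t * ((trunc k b s - trunc m b s) * (trunc k b t - trunc m b t)))"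
      by (intro pairing_second_moment_bounded[where m = "real k"] square_integrable_trunc b) auto
    have "(LINT (s, t)|(\<mu> \<Otimes>\<^sub>M \<mu>). C s t * ((trunc k b s - trunc m b s) * (trunc k b t - trunc m b t)))
      \<le> tail b m"
      unfolding tail_def split_beta'
    proof (rule integral_mono)
      show "integrable (\<mu> \<Otimes>\<^sub>M \<mu>) (\<lambda>z. C (fst z) (snd z) *
          ((trunc k b (fst z) - trunc m b (fst z)) * (trunc k b (snd z) - trunc m b (snd z))))"
        using C_mult_integrable[of "\<lambda>t. trunc k b t - trunc m b t" "\<lambda>t. trunc k b t - trunc m b t"]
          square_integrable_trunc(3)[OF assms] by (simp add: split_beta')
      have *: "\<bar>trunc k b t - trunc m b t\<bar> \<le> \<bar>b t - trunc m b t\<bar>" for t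
        using mk[of t] by (cases "pointwise_second_moment t \<le> of_nat m") (simp_all add: trunc_def)
      have "\<bar>C (fst z) (snd z) * ((trunc k b (fst z) - trunc m b (fst z)) * (trunc k b (snd z) - trunc m b (snd z)))\<bar>
          \<le> \<bar>C (fst z) (snd z)\<bar> * (\<bar>b (fst z) - trunc m b (fst z)\<bar> * \<bar>b (snd z) - trunc m b (snd z)\<bar>)" for z
        unfolding abs_mult by (intro mult_left_mono mult_mono *) auto
      then show "C (fst z) (snd z) * ((trunc k b (fst z) - trunc m b (fst z)) * (trunc k b (snd z) - trunc m b (snd z)))
          \<le> \<bar>C (fst z) (snd z)\<bar> * (\<bar>b (fst z) - trunc m b (fst z)\<bar> * \<bar>b (snd z) - trunc m b (snd z)\<bar>)" for z
        by (rule abs_le_D1)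
    qed (rule tail_int)
    then show ?thesis using V
      by (subst nn_integral_eq_integral) (auto simp: has_bochner_integral_iff intro: ennreal_leI)
  qed
  have lim: "(\<lambda>k. ?V k \<omega>) \<longlonglongrightarrow> ?W \<omega>" if \<omega>: "\<omega> \<in> space M" for \<omega>
  proof (rule integral_dominated_convergence[where w = "\<lambda>t. \<bar>Y \<omega> t * b t\<bar>"])
    show "integrable \<mu> (\<lambda>t. \<bar>Y \<omega> t * b t\<bar>)"
      using Y_mult_integrable[of b \<omega>] b \<omega> by simp
    show "AE t in \<mu>. (\<lambda>k. Y \<omega> t * (trunc k b t - trunc m b t)) \<longlonglongrightarrow> Y \<omega> t * (b t - trunc m b t)"
      using AE_trunc_eventually[of b]
    proof eventually_elim
      case (elim t)
      then show ?case by (intro tendsto_eventually) (auto elim: eventually_mono)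
    qed
    show "AE t in \<mu>. norm (Y \<omega> t * (trunc k b t - trunc m b t)) \<le> \<bar>Y \<omega> t * b t\<bar>" for k
      by (auto simp: trunc_def abs_mult)
  qed (use \<omega> in measurable)
  have "(\<integral>\<^sup>+\<omega>. ennreal ((?W \<omega>)\<^sup>2) \<partial>M) = (\<integral>\<^sup>+\<omega>. liminf (\<lambda>k. ennreal ((?V k \<omega>)\<^sup>2)) \<partial>M)"
  proof (rule nn_integral_cong)
    fix \<omega> assume "\<omega> \<in> space M"
    then have "(\<lambda>k. ennreal ((?V k \<omega>)\<^sup>2)) \<longlonglongrightarrow> ennreal ((?W \<omega>)\<^sup>2)"
      by (intro tendsto_ennrealI tendsto_power lim)
    then show "ennreal ((?W \<omega>)\<^sup>2) = liminf (\<lambda>k. ennreal ((?V k \<omega>)\<^sup>2))"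
      by (rule lim_imp_Liminf[OF sequentially_bot _, symmetric])
  qed
  also have "\<dots> \<le> liminf (\<lambda>k. \<integral>\<^sup>+\<omega>. ennreal ((?V k \<omega>)\<^sup>2) \<partial>M)"
    by (rule nn_integral_liminf) measurable
  also have "\<dots> \<le> liminf (\<lambda>k. ennreal (tail b m))"
    by (intro Liminf_mono) (auto simp: eventually_sequentially intro!: exI[of _ m] bound)
  also have "\<dots> = ennreal (tail b m)" by (simp add: Liminf_const)
  finally have le: "(\<integral>\<^sup>+\<omega>. ennreal ((?W \<omega>)\<^sup>2) \<partial>M) \<le> ennreal (tail b m)" .
  show int: "integrable M (\<lambda>\<omega>. (?W \<omega>)\<^sup>2)"
    using le by (intro integrableI_nonneg) (auto intro: le_less_trans)
  have "tail b m \<ge> 0" unfolding tail_def by (rule Bochner_Integration.integral_nonneg) auto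
  then show "(LINT \<omega>|M. (?W \<omega>)\<^sup>2) \<le> tail b m"
    using le int by (subst (asm) nn_integral_eq_integral) auto
qed

text \<open>
  The pairings with the truncations of \<open>b\<close> converge to the pairing with \<open>b\<close> in mean square, while
  dominated convergence applies to the double integral of the kernel.
\<close>

theorem pairing_second_moment:
  assumes [measurable]: "b \<in> borel_measurable \<mu>" and b: "integrable \<mu> (\<lambda>t. (b t)\<^sup>2)"
  shows "has_bochner_integral M (\<lambda>\<omega>. (pairing b \<omega>)\<^sup>2) (LINT (s, t)|(\<mu> \<Otimes>\<^sub>M \<mu>). C s t * (b s * b t))"
proof -
  let ?U = "pairing b" and ?V = "\<lambda>m. pairing (trunc m b)" and ?W = "\<lambda>m. pairing (\<lambda>t. b t - trunc m b t)"
  have V: "has_bochner_integral M (\<lambda>\<omega>. (?V m \<omega>)\<^sup>2)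
      (LINT (s, t)|(\<mu> \<Otimes>\<^sub>M \<mu>). C s t * (trunc m b s * trunc m b t))" for m
    by (intro pairing_second_moment_bounded[where m = "real m"] square_integrable_trunc b)
      (auto simp: trunc_def ennreal_of_nat_eq_real_of_nat split: if_splits)
  have W: "?W m \<omega> = ?U \<omega> - ?V m \<omega>" if "\<omega> \<in> space M" for m \<omega>
    using that b square_integrable_trunc[OF assms] by (intro pairing_diff) auto
  have Wint: "integrable M (\<lambda>\<omega>. (?W m \<omega>)\<^sup>2)" for m by (rule pairing_tail) fact+
  have U: "integrable M (\<lambda>\<omega>. (?U \<omega>)\<^sup>2)"
  proof -
    have "integrable M (\<lambda>\<omega>. (?W 0 \<omega> + ?V 0 \<omega>)\<^sup>2)"
      using Wint V by (intro integrable_square_add) (auto simp: has_bochner_integral_iff)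
    then show ?thesis
      by (rule Bochner_Integration.integrable_cong[THEN iffD1, rotated 2]) (auto simp: W)
  qed
  have UW: "integrable M (\<lambda>\<omega>. ?U \<omega> * ?W m \<omega>)" for m
    using U Wint by (intro integrable_mult_of_squares) auto
  have W0: "(\<lambda>m. LINT \<omega>|M. (?W m \<omega>)\<^sup>2) \<longlonglongrightarrow> 0"
    by (rule tendsto_sandwich[OF _ _ tendsto_const tail_tendsto_0[OF assms]])
      (auto intro!: always_eventually pairing_tail b)
  have UW0: "(\<lambda>m. LINT \<omega>|M. ?U \<omega> * ?W m \<omega>) \<longlonglongrightarrow> 0"
  proof -
    have "(\<lambda>m. (LINT \<omega>|M. (?U \<omega>)\<^sup>2) * (LINT \<omega>|M. (?W m \<omega>)\<^sup>2)) \<longlonglongrightarrow> 0"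
      using tendsto_mult_left[OF W0, of "LINT \<omega>|M. (?U \<omega>)\<^sup>2"] by simp
    then have "(\<lambda>m. (LINT \<omega>|M. ?U \<omega> * ?W m \<omega>)\<^sup>2) \<longlonglongrightarrow> 0"
      by (rule tendsto_sandwich[rotated 3, where f = "\<lambda>_. 0"])
        (auto intro!: always_eventually Cauchy_Schwarz_lebesgue_integral U Wint)
    then show ?thesis by (simp add: tendsto_null_power)
  qed
  have eq: "(LINT \<omega>|M. (?V m \<omega>)\<^sup>2)
      = (LINT \<omega>|M. (?U \<omega>)\<^sup>2) - 2 * (LINT \<omega>|M. ?U \<omega> * ?W m \<omega>) + (LINT \<omega>|M. (?W m \<omega>)\<^sup>2)" for m
  proof -
    have "(LINT \<omega>|M. (?V m \<omega>)\<^sup>2) = (LINT \<omega>|M. (?U \<omega>)\<^sup>2 - 2 * (?U \<omega> * ?W m \<omega>) + (?W m \<omega>)\<^sup>2)"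
    proof (rule Bochner_Integration.integral_cong)
      have *: "v\<^sup>2 = u\<^sup>2 - 2 * (u * w) + w\<^sup>2" if "w = u - v" for u v w :: real
        unfolding that by (simp add: power2_eq_square algebra_simps)
      show "(?V m \<omega>)\<^sup>2 = (?U \<omega>)\<^sup>2 - 2 * (?U \<omega> * ?W m \<omega>) + (?W m \<omega>)\<^sup>2" if "\<omega> \<in> space M" for \<omega>
        by (rule *[OF W[OF that]])
    qed simp
    then show ?thesis using U UW Wint by simp
  qed
  have "(\<lambda>m. LINT \<omega>|M. (?V m \<omega>)\<^sup>2) \<longlonglongrightarrow> (LINT \<omega>|M. (?U \<omega>)\<^sup>2) - 2 * 0 + 0"
    unfolding eq by (intro tendsto_intros UW0 W0)
  moreover have "(\<lambda>m. LINT \<omega>|M. (?V m \<omega>)\<^sup>2) \<longlonglongrightarrow> (LINT (s, t)|(\<mu> \<Otimes>\<^sub>M \<mu>). C s t * (b s * b t))"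
  proof -
    have "(\<lambda>m. LINT z|(\<mu> \<Otimes>\<^sub>M \<mu>). C (fst z) (snd z) * (trunc m b (fst z) * trunc m b (snd z)))
      \<longlonglongrightarrow> (LINT z|(\<mu> \<Otimes>\<^sub>M \<mu>). C (fst z) (snd z) * (b (fst z) * b (snd z)))"
    proof (rule integral_dominated_convergence
        [where w = "\<lambda>z. \<bar>C (fst z) (snd z) * (b (fst z) * b (snd z))\<bar>"])
      show "integrable (\<mu> \<Otimes>\<^sub>M \<mu>) (\<lambda>z. \<bar>C (fst z) (snd z) * (b (fst z) * b (snd z))\<bar>)"
        using C_mult_integrable[of b b] b by (intro integrable_abs) (simp add: split_beta')
      show "AE z in \<mu> \<Otimes>\<^sub>M \<mu>. (\<lambda>m. C (fst z) (snd z) * (trunc m b (fst z) * trunc m b (snd z)))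
          \<longlonglongrightarrow> C (fst z) (snd z) * (b (fst z) * b (snd z))"
        using AE_pair_second_moment_finite
      proof eventually_elim
        case (elim z)
        then have "pointwise_second_moment (fst z) < \<infinity>" "pointwise_second_moment (snd z) < \<infinity>" by simp_all
        note trunc_eventually[OF this(1), of b] trunc_eventually[OF this(2), of b]
        from eventually_conj[OF this] show ?case
          by (rule tendsto_eventually[OF eventually_mono]) simp
      qed
      show "AE z in \<mu> \<Otimes>\<^sub>M \<mu>. norm (C (fst z) (snd z) * (trunc m b (fst z) * trunc m b (snd z)))
          \<le> \<bar>C (fst z) (snd z) * (b (fst z) * b (snd z))\<bar>" for m
        by (auto simp: trunc_def abs_mult)
    qed auto
    then show ?thesis using V by (simp add: has_bochner_integral_iff split_beta')
  qed
  ultimately have "(LINT \<omega>|M. (?U \<omega>)\<^sup>2) = (LINT (s, t)|(\<mu> \<Otimes>\<^sub>M \<mu>). C s t * (b s * b t))"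
    using LIMSEQ_unique by fastforce
  then show ?thesis using U by (simp add: has_bochner_integral_iff)
qed

text \<open>
  The quadratic form $\langle L_C b, b'\rangle$ of the covariance operator.
\<close>

definition Cov :: "('t \<Rightarrow> real) \<Rightarrow> ('t \<Rightarrow> real) \<Rightarrow> real" where
  "Cov b b' = (LINT (s, t)|(\<mu> \<Otimes>\<^sub>M \<mu>). C s t * (b s * b' t))"

lemma Cov_commute:
  assumes [measurable]: "b \<in> borel_measurable \<mu>" "b' \<in> borel_measurable \<mu>"
  shows "Cov b b' = Cov b' b"
proof -
  have "Cov b b' = (LINT z|(\<mu> \<Otimes>\<^sub>M \<mu>). (\<lambda>(s, t). C s t * (b s * b' t)) (snd z, fst z))"
    unfolding Cov_def
    by (subst \<mu>\<mu>.integral_product_swap[symmetric]) (auto simp: split_beta')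
  also have "\<dots> = Cov b' b"
    unfolding Cov_def by (simp add: split_beta' C mult_ac)
  finally show ?thesis .
qed

lemma integral_op_square_integrable:
  assumes [measurable]: "b \<in> borel_measurable \<mu>" and b: "integrable \<mu> (\<lambda>t. (b t)\<^sup>2)"
  shows "(\<lambda>t. LINT s|\<mu>. C s t * b s) \<in> borel_measurable \<mu>"
    and "integrable \<mu> (\<lambda>t. (LINT s|\<mu>. C s t * b s)\<^sup>2)"
proof -
  show meas: "(\<lambda>t. LINT s|\<mu>. C s t * b s) \<in> borel_measurable \<mu>" by measurable
  have "integrable (\<mu> \<Otimes>\<^sub>M \<mu>) (case_prod (\<lambda>s t. (C s t)\<^sup>2))" using C_sq .
  note C2 = \<mu>\<mu>.AE_integrable_snd[OF this] \<mu>\<mu>.integrable_snd[OF this]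
  show "integrable \<mu> (\<lambda>t. (LINT s|\<mu>. C s t * b s)\<^sup>2)"
  proof (rule Bochner_Integration.integrable_bound)
    show "integrable \<mu> (\<lambda>t. (LINT s|\<mu>. (C s t)\<^sup>2) * (LINT s|\<mu>. (b s)\<^sup>2))"
      using C2(2) by simp
    show "AE t in \<mu>. norm ((LINT s|\<mu>. C s t * b s)\<^sup>2)
        \<le> norm ((LINT s|\<mu>. (C s t)\<^sup>2) * (LINT s|\<mu>. (b s)\<^sup>2))"
      using C2(1) AE_space
    proof eventually_elim
      case (elim t)
      note [measurable] = elim(2)
      have "(LINT s|\<mu>. C s t * b s)\<^sup>2 \<le> (LINT s|\<mu>. (C s t)\<^sup>2) * (LINT s|\<mu>. (b s)\<^sup>2)"
        by (rule Cauchy_Schwarz_lebesgue_integral) (use elim b in auto)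
      then show ?case by simp
    qed
  qed (use meas in measurable)
qed

lemma Cov_eq_integral_op:
  assumes [measurable]: "b \<in> borel_measurable \<mu>" "b' \<in> borel_measurable \<mu>"
    and "integrable \<mu> (\<lambda>t. (b t)\<^sup>2)" "integrable \<mu> (\<lambda>t. (b' t)\<^sup>2)"
  shows "Cov b b' = (LINT t|\<mu>. (LINT s|\<mu>. C s t * b s) * b' t)"
proof -
  have "integrable (\<mu> \<Otimes>\<^sub>M \<mu>) (case_prod (\<lambda>s t. C s t * (b s * b' t)))"
    using C_mult_integrable[OF assms] by simp
  then have "Cov b b' = (LINT t|\<mu>. LINT s|\<mu>. C s t * (b s * b' t))"
    unfolding Cov_def using \<mu>\<mu>.integral_snd by fastforce
  then show ?thesis by (simp add: mult.assoc[symmetric])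
qed

lemma second_moment_diff:
  assumes [measurable]: "b \<in> borel_measurable \<mu>" "b' \<in> borel_measurable \<mu>"
    and b: "integrable \<mu> (\<lambda>t. (b t)\<^sup>2)" and b': "integrable \<mu> (\<lambda>t. (b' t)\<^sup>2)"
  shows "(LINT \<omega>|M. (pairing (\<lambda>t. b t - b' t) \<omega>)\<^sup>2) = Cov b b - 2 * Cov b b' + Cov b' b'"
proof -
  have "integrable \<mu> (\<lambda>t. (b t + - b' t)\<^sup>2)"
    using b b' by (intro integrable_square_add) auto
  then have d: "integrable \<mu> (\<lambda>t. (b t - b' t)\<^sup>2)" by simp
  have "(LINT \<omega>|M. (pairing (\<lambda>t. b t - b' t) \<omega>)\<^sup>2) = Cov (\<lambda>t. b t - b' t) (\<lambda>t. b t - b' t)"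
    using pairing_second_moment[OF _ d] by (simp add: Cov_def has_bochner_integral_iff)
  also have "\<dots> = Cov b b - Cov b b' - Cov b' b + Cov b' b'"
    using C_mult_integrable[of b b] C_mult_integrable[of b b'] C_mult_integrable[of b' b]
      C_mult_integrable[of b' b'] b b' unfolding Cov_def
    by (simp add: split_beta' algebra_simps)
  finally show ?thesis using Cov_commute[of b b'] by simp
qed

text \<open>
  The Hilbert--Schmidt norm of the kernel bounds its quadratic form.
\<close>

lemma second_moment_bound:
  assumes [measurable]: "b \<in> borel_measurable \<mu>" and b: "integrable \<mu> (\<lambda>t. (b t)\<^sup>2)"
  shows "integrable M (\<lambda>\<omega>. (pairing b \<omega>)\<^sup>2)"
    "(LINT \<omega>|M. (pairing b \<omega>)\<^sup>2) \<le> sqrt (LINT (s, t)|(\<mu> \<Otimes>\<^sub>M \<mu>). (C s t)\<^sup>2) * (LINT t|\<mu>. (b t)\<^sup>2)"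
proof -
  note b2 = pairing_second_moment[OF assms]
  then show "integrable M (\<lambda>\<omega>. (pairing b \<omega>)\<^sup>2)" by (simp add: has_bochner_integral_iff)
  note prod = \<mu>\<mu>.has_bochner_integral_pair_mult[OF b b]
  have "(LINT z|(\<mu> \<Otimes>\<^sub>M \<mu>). C (fst z) (snd z) * (b (fst z) * b (snd z)))\<^sup>2
      \<le> (LINT z|(\<mu> \<Otimes>\<^sub>M \<mu>). (C (fst z) (snd z))\<^sup>2) * (LINT z|(\<mu> \<Otimes>\<^sub>M \<mu>). (b (fst z) * b (snd z))\<^sup>2)"
    by (rule Cauchy_Schwarz_lebesgue_integral)
      (use C_sq prod in \<open>auto simp: split_beta' has_bochner_integral_iff power_mult_distrib\<close>)
  also have "(LINT z|(\<mu> \<Otimes>\<^sub>M \<mu>). (b (fst z) * b (snd z))\<^sup>2) = (LINT t|\<mu>. (b t)\<^sup>2)\<^sup>2"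
    using prod by (simp add: split_beta' has_bochner_integral_iff power_mult_distrib power2_eq_square[of "LINT t|\<mu>. (b t)\<^sup>2"])
  finally have "\<bar>LINT z|(\<mu> \<Otimes>\<^sub>M \<mu>). C (fst z) (snd z) * (b (fst z) * b (snd z))\<bar>
      \<le> sqrt ((LINT z|(\<mu> \<Otimes>\<^sub>M \<mu>). (C (fst z) (snd z))\<^sup>2) * (LINT t|\<mu>. (b t)\<^sup>2)\<^sup>2)"
    by (intro real_le_rsqrt) simp
  also have "\<dots> = sqrt (LINT z|(\<mu> \<Otimes>\<^sub>M \<mu>). (C (fst z) (snd z))\<^sup>2) * (LINT t|\<mu>. (b t)\<^sup>2)"
    by (simp add: real_sqrt_mult)
  finally show "(LINT \<omega>|M. (pairing b \<omega>)\<^sup>2)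
      \<le> sqrt (LINT (s, t)|(\<mu> \<Otimes>\<^sub>M \<mu>). (C s t)\<^sup>2) * (LINT t|\<mu>. (b t)\<^sup>2)"
    using b2 by (simp add: has_bochner_integral_iff split_beta')
qed

end

section \<open>The Borel space of square-integrable functions\<close>

lemma L2_D:
  assumes "f \<in> L2 T"
  shows "f \<in> borel_measurable (lebesgue_on T)" "integrable (lebesgue_on T) (\<lambda>t. (f t)\<^sup>2)"
  using assms by (auto simp: L2_def)

lemma L2_lincomb:
  assumes "f \<in> L2 T" "g \<in> L2 T"
  shows "(\<lambda>t. a * f t + b * g t) \<in> L2 T"
  using integrable_square_add[of "\<lambda>t. a * f t" "lebesgue_on T" "\<lambda>t. b * g t"] L2_D[OF assms(1)] L2_D[OF assms(2)]
  by (auto simp: L2_def power_mult_distrib)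

lemma L2_diff: "f \<in> L2 T \<Longrightarrow> g \<in> L2 T \<Longrightarrow> (\<lambda>t. f t - g t) \<in> L2 T"
  using L2_lincomb[of f T g 1 "-1"] by simp

lemma L2_zero: "(\<lambda>_. 0) \<in> L2 T"
  by (simp add: L2_def)

lemma space_L2_borel: "space (L2_borel T) = L2 T"
  unfolding L2_borel_def by (rule space_measure_of) (auto simp: L2_open_def)

lemma L2_norm_eq: "L2_norm T f = sqrt (LINT t|lebesgue_on T. (f t)\<^sup>2)"
  by (simp add: L2_norm_def L2_inner_def power2_eq_square)

lemma L2_inner_Cauchy_Schwarz:
  assumes "f \<in> L2 T" "g \<in> L2 T"
  shows "\<bar>L2_inner T f g\<bar> \<le> L2_norm T f * L2_norm T g"
proof -
  have "(L2_inner T f g)\<^sup>2 \<le> (LINT t|lebesgue_on T. (f t)\<^sup>2) * (LINT t|lebesgue_on T. (g t)\<^sup>2)"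
    unfolding L2_inner_def by (rule Cauchy_Schwarz_lebesgue_integral) (use L2_D assms in auto)
  then show ?thesis
    unfolding L2_norm_eq real_sqrt_mult[symmetric] by (intro real_le_rsqrt) simp
qed

lemma L2_mult_integrable:
  assumes "f \<in> L2 T" "g \<in> L2 T"
  shows "integrable (lebesgue_on T) (\<lambda>t. f t * g t)"
  by (rule integrable_mult_of_squares) (use L2_D assms in auto)

lemma L2_inner_diff_left:
  assumes "f \<in> L2 T" "g \<in> L2 T" "h \<in> L2 T"
  shows "L2_inner T (\<lambda>t. f t - g t) h = L2_inner T f h - L2_inner T g h"
  using L2_mult_integrable[OF assms(1,3)] L2_mult_integrable[OF assms(2,3)]
  by (simp add: L2_inner_def left_diff_distrib)

lemma L2_inner_commute: "L2_inner T f g = L2_inner T g f"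
  by (simp add: L2_inner_def mult.commute)

lemma L2_inner_cong:
  assumes "L2_eq T f f'" "f \<in> L2 T" "f' \<in> borel_measurable (lebesgue_on T)" "g \<in> L2 T"
  shows "L2_inner T f g = L2_inner T f' g"
  unfolding L2_inner_def
  by (rule integral_cong_AE) (use assms L2_D in \<open>auto simp: L2_eq_def\<close>)

text \<open>
  The sets of \<open>L2_borel\<close> are generated by the norm-open sets, so continuity yields measurability. All
  functionals of a slope that occur in the risk are Lipschitz after taking a square root or
  polarizing.
\<close>

lemma borel_measurable_L2_Lipschitz:
  fixes F :: "(real \<Rightarrow> real) \<Rightarrow> real"
  assumes F: "\<And>f g. f \<in> L2 T \<Longrightarrow> g \<in> L2 T \<Longrightarrow> \<bar>F g - F f\<bar> \<le> L * L2_norm T (\<lambda>t. g t - f t)"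
  shows "F \<in> borel_measurable (L2_borel T)"
proof (rule borel_measurableI)
  fix S :: "real set" assume S: "open S"
  have "L2_open T (F -` S \<inter> L2 T)"
    unfolding L2_open_def
  proof (intro conjI ballI)
    fix f assume f: "f \<in> F -` S \<inter> L2 T"
    then obtain e where e: "e > 0" "\<And>y. dist y (F f) < e \<Longrightarrow> y \<in> S"
      using S unfolding open_dist by blast
    show "\<exists>e>0. \<forall>g\<in>L2 T. L2_norm T (\<lambda>t. g t - f t) < e \<longrightarrow> g \<in> F -` S \<inter> L2 T"
    proof (intro exI[of _ "e / (\<bar>L\<bar> + 1)"] conjI ballI impI)
      show "e / (\<bar>L\<bar> + 1) > 0" using e by simp
      fix g assume g: "g \<in> L2 T" and lt: "L2_norm T (\<lambda>t. g t - f t) < e / (\<bar>L\<bar> + 1)"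
      have n0: "L2_norm T (\<lambda>t. g t - f t) \<ge> 0" by (simp add: L2_norm_eq)
      have "\<bar>F g - F f\<bar> \<le> L * L2_norm T (\<lambda>t. g t - f t)" using F f g by auto
      also have "\<dots> \<le> (\<bar>L\<bar> + 1) * L2_norm T (\<lambda>t. g t - f t)"
        using n0 by (intro mult_right_mono) auto
      also have "\<dots> < e" using lt by (simp add: pos_less_divide_eq mult.commute)
      finally show "g \<in> F -` S \<inter> L2 T" using e(2) g by (auto simp: dist_real_def)
    qed
  qed auto
  then show "F -` S \<inter> space (L2_borel T) \<in> sets (L2_borel T)"
    unfolding space_L2_borel unfolding L2_borel_def by (intro in_measure_of) (auto simp: L2_open_def)
qed

lemma borel_measurable_L2_inner:
  assumes "b \<in> L2 T"
  shows "(\<lambda>y. L2_inner T y b) \<in> borel_measurable (L2_borel T)"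
proof (rule borel_measurable_L2_Lipschitz)
  fix f g assume "f \<in> L2 T" "g \<in> L2 T"
  then show "\<bar>L2_inner T g b - L2_inner T f b\<bar> \<le> L2_norm T b * L2_norm T (\<lambda>t. g t - f t)"
    using L2_inner_Cauchy_Schwarz[OF L2_diff[of g T f] assms]
    by (simp add: L2_inner_diff_left assms mult.commute)
qed

lemma finite_measure_lebesgue_on_compact: "compact T \<Longrightarrow> finite_measure (lebesgue_on T)"
  using fmeasurableD2[OF lmeasurable_compact[of T]] fmeasurableD[OF lmeasurable_compact[of T]]
  by (intro finite_measureI) (auto simp: emeasure_restrict_space)

section \<open>Prediction risk in the partially functional linear model\<close>

text \<open>
  The linear model for one sample size, reduced to what makes the risk of every parameter finite and
  measurable.
\<close>

locale regression_model =
  second_order_process M "lebesgue_on T" Y "covariance_fun M Y"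
  for M :: "'w measure" and T :: "real set" and Y :: "'w \<Rightarrow> real \<Rightarrow> real" +
  fixes p :: nat and X :: "'w \<Rightarrow> nat \<Rightarrow> real" and eps :: "'w \<Rightarrow> real"
  assumes X[measurable]: "X \<in> measurable M (Rvec p)"
    and Y_L2[measurable]: "Y \<in> measurable M (L2_borel T)"
    and eps[measurable]: "eps \<in> borel_measurable M"
    and X_sq: "\<And>i. i < p \<Longrightarrow> integrable M (\<lambda>\<omega>. (X \<omega> i)\<^sup>2)"
    and eps_sq: "integrable M (\<lambda>\<omega>. (eps \<omega>)\<^sup>2)"
begin

abbreviation law :: "param \<Rightarrow> obs measure" where
  "law \<equiv> obs_law M T p X Y eps"

definition params :: "param set" where
  "params = space (Rvec p) \<times> L2 T"

lemma params_eq: "params = space (Rvec p \<Otimes>\<^sub>M L2_borel T)"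
  by (simp add: params_def space_pair_measure space_L2_borel)

lemma vdot_measurable[measurable]: "(\<lambda>x. vdot p x a) \<in> borel_measurable (Rvec p)"
  unfolding vdot_def Rvec_def by measurable

lemma X_component_measurable[measurable]: "i < p \<Longrightarrow> (\<lambda>\<omega>. X \<omega> i) \<in> borel_measurable M"
  using X unfolding Rvec_def by measurable

lemma L2_inner_eq_pairing: "L2_inner T (Y \<omega>) b = pairing b \<omega>"
  by (simp add: L2_inner_def)

lemma predict_measurable:
  assumes "\<theta> \<in> params"
  shows "(\<lambda>(x, y). predict T p \<theta> x y) \<in> borel_measurable (Rvec p \<Otimes>\<^sub>M L2_borel T)"
proof -
  have [measurable]: "(\<lambda>y. L2_inner T y (snd \<theta>)) \<in> borel_measurable (L2_borel T)"
    using assms by (intro borel_measurable_L2_inner) (auto simp: params_def)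
  show ?thesis unfolding predict_def by measurable
qed

lemma predictor_measurable[measurable]:
  assumes "\<theta> \<in> params"
  shows "(\<lambda>\<omega>. predict T p \<theta> (X \<omega>) (Y \<omega>)) \<in> borel_measurable M"
proof -
  have "(\<lambda>\<omega>. (X \<omega>, Y \<omega>)) \<in> measurable M (Rvec p \<Otimes>\<^sub>M L2_borel T)" by measurable
  from measurable_compose[OF this predict_measurable[OF assms]] show ?thesis by simp
qed

lemma observation_measurable:
  assumes "\<theta> \<in> params"
  shows "(\<lambda>\<omega>. (predict T p \<theta> (X \<omega>) (Y \<omega>) + eps \<omega>, X \<omega>, Y \<omega>)) \<in> measurable M (obs_space T p)"
  using predictor_measurable[OF assms] unfolding obs_space_def by measurable

lemma prob_space_law: "\<theta> \<in> params \<Longrightarrow> prob_space (law \<theta>)"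
  unfolding obs_law_def by (intro M.prob_space_distr observation_measurable)

lemma sets_law[simp, measurable_cong]: "sets (law \<theta>) = sets (obs_space T p)"
  by (simp add: obs_law_def)

lemma pairing_square_integrable: "b \<in> L2 T \<Longrightarrow> integrable M (\<lambda>\<omega>. (pairing b \<omega>)\<^sup>2)"
  using second_moment_bound(1) L2_D by blast

lemma predictor_square_integrable:
  assumes "\<theta> \<in> params"
  shows "integrable M (\<lambda>\<omega>. (predict T p \<theta> (X \<omega>) (Y \<omega>))\<^sup>2)"
proof -
  have "integrable M (\<lambda>\<omega>. (\<Sum>i<q. X \<omega> i * fst \<theta> i)\<^sup>2) \<and> (\<lambda>\<omega>. \<Sum>i<q. X \<omega> i * fst \<theta> i) \<in> borel_measurable M"
    if "q \<le> p" for q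
    using that
  proof (induction q)
    case (Suc q)
    then show ?case
      using X_sq[of q] integrable_square_add[of "\<lambda>\<omega>. \<Sum>i<q. X \<omega> i * fst \<theta> i" M "\<lambda>\<omega>. X \<omega> q * fst \<theta> q"]
      by (auto simp: power_mult_distrib)
  qed simp
  then have "integrable M (\<lambda>\<omega>. (vdot p (X \<omega>) (fst \<theta>))\<^sup>2)" "(\<lambda>\<omega>. vdot p (X \<omega>) (fst \<theta>)) \<in> borel_measurable M"
    by (auto simp: vdot_def)
  moreover have "snd \<theta> \<in> L2 T" using assms by (auto simp: params_def)
  ultimately show ?thesis
    using pairing_square_integrable[of "snd \<theta>"] L2_D[of "snd \<theta>"]
    unfolding predict_def L2_inner_eq_pairing by (intro integrable_square_add) auto
qed

lemma risk_eq:
  assumes \<theta>: "\<theta> \<in> params" and \<theta>': "\<theta>' \<in> params"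
  shows "risk T p (law \<theta>) \<theta>'
    = (LINT \<omega>|M. (predict T p \<theta> (X \<omega>) (Y \<omega>) + eps \<omega> - predict T p \<theta>' (X \<omega>) (Y \<omega>))\<^sup>2)"
proof -
  note [measurable] = predict_measurable[OF \<theta>']
  have "(\<lambda>(z, x, y). (z - predict T p \<theta>' x y)\<^sup>2) \<in> borel_measurable (obs_space T p)"
    unfolding obs_space_def by measurable
  then show ?thesis
    unfolding risk_def obs_law_def
    by (subst integral_distr[OF observation_measurable[OF \<theta>]]) auto
qed

text \<open>
  The root mean square of a residual is a seminorm distance, and the seminorm
  $b \mapsto (\mathrm E\langle Y,b\rangle^2)^{1/2}$ is bounded on $L^2$.
\<close>

lemma residual_L2_Lipschitz:
  fixes V :: "'w \<Rightarrow> real"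
  assumes [measurable]: "V \<in> borel_measurable M" and V: "integrable M (\<lambda>\<omega>. (V \<omega>)\<^sup>2)"
  defines "\<kappa> \<equiv> sqrt (LINT (s, t)|(lebesgue_on T \<Otimes>\<^sub>M lebesgue_on T). (covariance_fun M Y s t)\<^sup>2)"
  assumes f: "f \<in> L2 T" and g: "g \<in> L2 T"
  shows "sqrt (LINT \<omega>|M. (V \<omega> - pairing g \<omega>)\<^sup>2)
      \<le> sqrt (LINT \<omega>|M. (V \<omega> - pairing f \<omega>)\<^sup>2) + sqrt \<kappa> * L2_norm T (\<lambda>t. f t - g t)"
proof -
  have fg: "(\<lambda>t. f t - g t) \<in> L2 T" using f g by (rule L2_diff)
  note [measurable] = L2_D(1)[OF f] L2_D(1)[OF g] L2_D(1)[OF fg]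
  have int: "integrable M (\<lambda>\<omega>. (V \<omega> - pairing f \<omega>)\<^sup>2)"
    using integrable_square_add[of V M "\<lambda>\<omega>. - pairing f \<omega>"] V pairing_square_integrable[OF f] by simp
  have "sqrt (LINT \<omega>|M. (V \<omega> - pairing g \<omega>)\<^sup>2)
      = sqrt (LINT \<omega>|M. ((V \<omega> - pairing f \<omega>) + pairing (\<lambda>t. f t - g t) \<omega>)\<^sup>2)"
  proof (intro arg_cong[where f = sqrt] Bochner_Integration.integral_cong refl)
    fix \<omega> assume "\<omega> \<in> space M"
    then have "pairing (\<lambda>t. f t - g t) \<omega> = pairing f \<omega> - pairing g \<omega>"
      using f g by (intro pairing_diff L2_D)
    then show "(V \<omega> - pairing g \<omega>)\<^sup>2 = ((V \<omega> - pairing f \<omega>) + pairing (\<lambda>t. f t - g t) \<omega>)\<^sup>2" by simp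
  qed
  also have "\<dots> \<le> sqrt (LINT \<omega>|M. (V \<omega> - pairing f \<omega>)\<^sup>2)
      + sqrt (LINT \<omega>|M. (pairing (\<lambda>t. f t - g t) \<omega>)\<^sup>2)"
    by (rule Minkowski_lebesgue_integral) (use int pairing_square_integrable[OF fg] in auto)
  also have "sqrt (LINT \<omega>|M. (pairing (\<lambda>t. f t - g t) \<omega>)\<^sup>2)
      \<le> sqrt (\<kappa> * (LINT t|lebesgue_on T. (f t - g t)\<^sup>2))"
    unfolding \<kappa>_def by (intro real_sqrt_le_mono second_moment_bound(2) L2_D[OF fg])
  finally show ?thesis by (simp add: L2_norm_eq real_sqrt_mult)
qed

lemma L2_norm_minus_commute: "L2_norm T (\<lambda>t. f t - g t) = L2_norm T (\<lambda>t. g t - f t)"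
  by (simp add: L2_norm_eq power2_commute)

lemma measurable_residual_moment:
  fixes V :: "'w \<Rightarrow> real"
  assumes V: "V \<in> borel_measurable M" "integrable M (\<lambda>\<omega>. (V \<omega>)\<^sup>2)"
  shows "(\<lambda>b. LINT \<omega>|M. (V \<omega> - pairing b \<omega>)\<^sup>2) \<in> borel_measurable (L2_borel T)"
proof -
  have "(\<lambda>b. sqrt (LINT \<omega>|M. (V \<omega> - pairing b \<omega>)\<^sup>2)) \<in> borel_measurable (L2_borel T)"
  proof (rule borel_measurable_L2_Lipschitz)
    fix f g assume "f \<in> L2 T" "g \<in> L2 T"
    from residual_L2_Lipschitz[OF V this] residual_L2_Lipschitz[OF V this(2,1)]
    show "\<bar>sqrt (LINT \<omega>|M. (V \<omega> - pairing g \<omega>)\<^sup>2) - sqrt (LINT \<omega>|M. (V \<omega> - pairing f \<omega>)\<^sup>2)\<bar>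
      \<le> sqrt (sqrt (LINT (s, t)|(lebesgue_on T \<Otimes>\<^sub>M lebesgue_on T). (covariance_fun M Y s t)\<^sup>2))
        * L2_norm T (\<lambda>t. g t - f t)"
      unfolding L2_norm_minus_commute[of f g] by linarith
  qed
  then have "(\<lambda>b. (sqrt (LINT \<omega>|M. (V \<omega> - pairing b \<omega>)\<^sup>2))\<^sup>2) \<in> borel_measurable (L2_borel T)"
    by measurable
  then show ?thesis by simp
qed

text \<open>
  The risk is a quadratic polynomial in the finite-dimensional coefficients; its coefficients are
  functions of the slope that are measurable by \<open>measurable_residual_moment\<close>. The joint measurability
  of the inner product in both arguments is thereby avoided.
\<close>

lemma risk_measurable:
  assumes \<theta>: "\<theta> \<in> params"
  shows "risk T p (law \<theta>) \<in> borel_measurable (Rvec p \<Otimes>\<^sub>M L2_borel T)"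
proof -
  define Z where "Z = (\<lambda>\<omega>. predict T p \<theta> (X \<omega>) (Y \<omega>) + eps \<omega>)"
  have Z[measurable]: "Z \<in> borel_measurable M" "integrable M (\<lambda>\<omega>. (Z \<omega>)\<^sup>2)"
    using predictor_measurable[OF \<theta>] predictor_square_integrable[OF \<theta>] eps_sq
    unfolding Z_def by (auto intro: integrable_square_add)
  define m2 where "m2 V b = (LINT \<omega>|M. (V \<omega> - pairing b \<omega>)\<^sup>2)" for V :: "'w \<Rightarrow> real" and b
  have m2[measurable]: "m2 V \<in> borel_measurable (L2_borel T)"
    if "V \<in> borel_measurable M" "integrable M (\<lambda>\<omega>. (V \<omega>)\<^sup>2)" for V
    unfolding m2_def[abs_def] by (rule measurable_residual_moment[OF that])
  (* The mixed moments E[X_i (Z - <Y, b>)] are obtained from squares by polarization. *)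
  define mix where "mix i b = (m2 (\<lambda>\<omega>. Z \<omega> + X \<omega> i) b - m2 Z b - (LINT \<omega>|M. (X \<omega> i)\<^sup>2)) / 2" for i b
  have mix_meas: "mix i \<in> borel_measurable (L2_borel T)" if "i < p" for i
  proof -
    note [measurable] = m2[OF Z] X_component_measurable[OF that]
    have [measurable]: "m2 (\<lambda>\<omega>. Z \<omega> + X \<omega> i) \<in> borel_measurable (L2_borel T)"
      using X_sq[OF that] Z by (intro m2 integrable_square_add) auto
    show ?thesis unfolding mix_def[abs_def] by measurable
  qed
  have expand: "risk T p (law \<theta>) (a, b) = m2 Z b - 2 * (\<Sum>i<p. a i * mix i b)
      + (\<Sum>i<p. \<Sum>j<p. a i * a j * (LINT \<omega>|M. X \<omega> i * X \<omega> j))"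
    if ab: "(a, b) \<in> params" for a b
  proof -
    have b: "b \<in> L2 T" using ab by (simp add: params_def)
    note [measurable] = L2_D(1)[OF b]
    have R: "integrable M (\<lambda>\<omega>. (Z \<omega> - pairing b \<omega>)\<^sup>2)"
      using integrable_square_add[of Z M "\<lambda>\<omega>. - pairing b \<omega>"] Z pairing_square_integrable[OF b] by simp
    have XX: "integrable M (\<lambda>\<omega>. X \<omega> i * X \<omega> j)" if "i < p" "j < p" for i j
      using that X_sq by (intro integrable_mult_of_squares) auto
    have XR: "integrable M (\<lambda>\<omega>. X \<omega> i * (Z \<omega> - pairing b \<omega>))" if "i < p" for i
      using that X_sq R by (intro integrable_mult_of_squares) auto
    have mix: "mix i b = (LINT \<omega>|M. X \<omega> i * (Z \<omega> - pairing b \<omega>))" if "i < p" for i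
    proof -
      have "m2 (\<lambda>\<omega>. Z \<omega> + X \<omega> i) b
          = (LINT \<omega>|M. (Z \<omega> - pairing b \<omega>)\<^sup>2 + 2 * (X \<omega> i * (Z \<omega> - pairing b \<omega>)) + (X \<omega> i)\<^sup>2)"
        unfolding m2_def
      proof (rule Bochner_Integration.integral_cong)
        fix \<omega>
        have "(z + x - y)\<^sup>2 = (z - y)\<^sup>2 + 2 * (x * (z - y)) + x\<^sup>2" for x y z :: real
          by (simp add: power2_eq_square algebra_simps)
        then show "(Z \<omega> + X \<omega> i - pairing b \<omega>)\<^sup>2
          = (Z \<omega> - pairing b \<omega>)\<^sup>2 + 2 * (X \<omega> i * (Z \<omega> - pairing b \<omega>)) + (X \<omega> i)\<^sup>2" .
      qed simp
      also have "\<dots> = m2 Z b + 2 * (LINT \<omega>|M. X \<omega> i * (Z \<omega> - pairing b \<omega>)) + (LINT \<omega>|M. (X \<omega> i)\<^sup>2)"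
        using R XR[OF that] X_sq[OF that] by (simp add: m2_def)
      finally show ?thesis by (simp add: mix_def)
    qed
    have "risk T p (law \<theta>) (a, b) = (LINT \<omega>|M. ((Z \<omega> - pairing b \<omega>) - vdot p (X \<omega>) a)\<^sup>2)"
      unfolding risk_eq[OF \<theta> ab] Z_def[symmetric]
      by (rule Bochner_Integration.integral_cong) (auto simp: Z_def predict_def L2_inner_eq_pairing algebra_simps)
    also have "\<dots> = (LINT \<omega>|M. (Z \<omega> - pairing b \<omega>)\<^sup>2 - 2 * (\<Sum>i<p. a i * (X \<omega> i * (Z \<omega> - pairing b \<omega>)))
        + (\<Sum>i<p. \<Sum>j<p. a i * a j * (X \<omega> i * X \<omega> j)))"
    proof (rule Bochner_Integration.integral_cong)
      fix \<omega>
      have 1: "r * vdot p x a = (\<Sum>i<p. a i * (x i * r))" for r x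
        by (simp add: vdot_def sum_distrib_left mult_ac)
      have 2: "(vdot p x a)\<^sup>2 = (\<Sum>i<p. \<Sum>j<p. a i * a j * (x i * x j))" for x
        by (simp add: vdot_def power2_eq_square sum_product mult_ac)
      have "(r - v)\<^sup>2 = r\<^sup>2 - 2 * (r * v) + v\<^sup>2" for r v :: real
        by (simp add: power2_eq_square algebra_simps)
      then show "((Z \<omega> - pairing b \<omega>) - vdot p (X \<omega>) a)\<^sup>2
        = (Z \<omega> - pairing b \<omega>)\<^sup>2 - 2 * (\<Sum>i<p. a i * (X \<omega> i * (Z \<omega> - pairing b \<omega>)))
        + (\<Sum>i<p. \<Sum>j<p. a i * a j * (X \<omega> i * X \<omega> j))"
        unfolding 1[symmetric] 2[symmetric] .
    qed simp
    also have "\<dots> = m2 Z b - 2 * (\<Sum>i<p. a i * mix i b)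
        + (\<Sum>i<p. \<Sum>j<p. a i * a j * (LINT \<omega>|M. X \<omega> i * X \<omega> j))"
    proof -
      have "integrable M (\<lambda>\<omega>. \<Sum>i<p. a i * (X \<omega> i * (Z \<omega> - pairing b \<omega>)))"
        "integrable M (\<lambda>\<omega>. \<Sum>i<p. \<Sum>j<p. a i * a j * (X \<omega> i * X \<omega> j))"
        using XR XX by (auto intro!: Bochner_Integration.integrable_sum integrable_mult_right)
      moreover have "(LINT \<omega>|M. (\<Sum>i<p. a i * (X \<omega> i * (Z \<omega> - pairing b \<omega>)))) = (\<Sum>i<p. a i * mix i b)"
        using XR mix by (subst Bochner_Integration.integral_sum) (auto intro!: integrable_mult_right)
      moreover have "(LINT \<omega>|M. (\<Sum>i<p. \<Sum>j<p. a i * a j * (X \<omega> i * X \<omega> j)))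
          = (\<Sum>i<p. \<Sum>j<p. a i * a j * (LINT \<omega>|M. X \<omega> i * X \<omega> j))"
      proof -
        have "(LINT \<omega>|M. (\<Sum>j<p. a i * a j * (X \<omega> i * X \<omega> j)))
            = (\<Sum>j<p. a i * a j * (LINT \<omega>|M. X \<omega> i * X \<omega> j))" if "i < p" for i
          using XX that by (subst Bochner_Integration.integral_sum) (auto intro!: integrable_mult_right)
        then show ?thesis
          using XX by (subst Bochner_Integration.integral_sum)
            (auto intro!: Bochner_Integration.integrable_sum integrable_mult_right)
      qed
      ultimately show ?thesis using R by (simp add: m2_def)
    qed
    finally show ?thesis .
  qed
  have "(\<lambda>(a, b). m2 Z b - 2 * (\<Sum>i<p. a i * mix i b)
      + (\<Sum>i<p. \<Sum>j<p. a i * a j * (LINT \<omega>|M. X \<omega> i * X \<omega> j)))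
    \<in> borel_measurable (Rvec p \<Otimes>\<^sub>M L2_borel T)"
  proof -
    have [measurable]: "(\<lambda>a. a i) \<in> borel_measurable (Rvec p)" "mix i \<in> borel_measurable (L2_borel T)"
      if "i \<in> {..<p}" for i
      using that by (auto simp: Rvec_def intro: mix_meas)
    note [measurable] = m2[OF Z]
    show ?thesis by measurable
  qed
  then show ?thesis
    by (rule measurable_cong[THEN iffD1, rotated]) (auto simp: expand params_eq[symmetric])
qed

lemma risk_self:
  assumes "\<theta> \<in> params"
  shows "risk T p (law \<theta>) \<theta> = (LINT \<omega>|M. (eps \<omega>)\<^sup>2)"
  by (simp add: risk_eq[OF assms assms])

text \<open>
  With \<open>W\<close> the difference of the two predictions, the excess risk is
  $\mathrm E(\varepsilon - W)^2 - \mathrm E\varepsilon^2$, and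
  $(\varepsilon - W)^2 \ge W^2/2 - \varepsilon^2$ pointwise.
\<close>

lemma small_excess_risk_imp_close:
  assumes \<theta>: "\<theta> \<in> params" and \<theta>': "\<theta>' \<in> params"
    and small: "risk T p (law \<theta>) \<theta>' - risk T p (law \<theta>) \<theta> < \<delta>"
  shows "(LINT \<omega>|M. (predict T p \<theta>' (X \<omega>) (Y \<omega>) - predict T p \<theta> (X \<omega>) (Y \<omega>))\<^sup>2)
    < 2 * \<delta> + 4 * (LINT \<omega>|M. (eps \<omega>)\<^sup>2)"
proof -
  define W where "W = (\<lambda>\<omega>. predict T p \<theta>' (X \<omega>) (Y \<omega>) - predict T p \<theta> (X \<omega>) (Y \<omega>))"
  have [measurable]: "W \<in> borel_measurable M"
    unfolding W_def using predictor_measurable \<theta> \<theta>' by simp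
  have W2: "integrable M (\<lambda>\<omega>. (W \<omega>)\<^sup>2)"
    using integrable_square_add[of "\<lambda>\<omega>. predict T p \<theta>' (X \<omega>) (Y \<omega>)" M "\<lambda>\<omega>. - predict T p \<theta> (X \<omega>) (Y \<omega>)"]
      predictor_measurable predictor_square_integrable \<theta> \<theta>' by (simp add: W_def)
  have "integrable M (\<lambda>\<omega>. (eps \<omega> + - W \<omega>)\<^sup>2)"
    using W2 eps_sq by (intro integrable_square_add) auto
  then have eW: "integrable M (\<lambda>\<omega>. (eps \<omega> - W \<omega>)\<^sup>2)" by simp
  have "(LINT \<omega>|M. (W \<omega>)\<^sup>2 / 2 - (eps \<omega>)\<^sup>2) \<le> (LINT \<omega>|M. (eps \<omega> - W \<omega>)\<^sup>2)"
  proof (rule integral_mono)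
    (* The difference of the two sides is half the square of \<open>2 * e - w\<close>. *)
    have "w\<^sup>2 / 2 - e\<^sup>2 \<le> (e - w)\<^sup>2" for w e :: real
      using zero_le_power2[of "2 * e - w"] by (simp add: power2_eq_square algebra_simps)
    then show "(W \<omega>)\<^sup>2 / 2 - (eps \<omega>)\<^sup>2 \<le> (eps \<omega> - W \<omega>)\<^sup>2" for \<omega> .
  qed (use W2 eps_sq eW in auto)
  also have "(LINT \<omega>|M. (eps \<omega> - W \<omega>)\<^sup>2) = risk T p (law \<theta>) \<theta>'"
    unfolding risk_eq[OF \<theta> \<theta>']
    by (rule Bochner_Integration.integral_cong) (auto simp: W_def algebra_simps)
  also have "\<dots> < \<delta> + (LINT \<omega>|M. (eps \<omega>)\<^sup>2)" using small by (simp add: risk_self[OF \<theta>])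
  finally show ?thesis using W2 eps_sq by (simp add: W_def)
qed

lemma excess_risk_prob_le_1:
  assumes "\<theta> \<in> params"
  shows "excess_risk_prob T p n (law \<theta>) \<theta> est \<delta> \<le> 1"
proof -
  interpret prob_space "\<Pi>\<^sub>M i\<in>{1..n}. law \<theta>" by (rule prob_space_PiM) (rule prob_space_law[OF assms])
  show ?thesis unfolding excess_risk_prob_def by (rule prob_le_1)
qed

text \<open>
  One estimate cannot have an excess risk less than \<open>\<delta>\<close> under two hypotheses whose slopes are far
  apart relative to \<open>\<delta>\<close> and the noise, so the events of success are disjoint.
\<close>

theorem excess_risk_prob_near_1:
  fixes \<beta> :: "nat \<Rightarrow> real \<Rightarrow> real"
  assumes est: "est \<in> estimators T p n"
    and \<alpha>: "\<alpha> \<in> space (Rvec p)" and \<beta>: "\<And>j. \<beta> j \<in> L2 T"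
    and sep: "\<And>i j. i \<noteq> j \<Longrightarrow> (LINT \<omega>|M. (pairing (\<lambda>t. \<beta> i t - \<beta> j t) \<omega>)\<^sup>2)
        \<ge> 4 * (2 * \<delta> + 4 * (LINT \<omega>|M. (eps \<omega>)\<^sup>2))"
    and \<theta>0: "\<theta>0 \<in> params" and KL: "\<And>j. KL_dist (law (\<alpha>, \<beta> j)) (law \<theta>0) \<le> ereal \<kappa>"
    and \<eta>: "\<eta> > 0"
  shows "\<exists>j. excess_risk_prob T p n (law (\<alpha>, \<beta> j)) (\<alpha>, \<beta> j) est \<delta> > 1 - \<eta>"
proof -
  define \<theta> where "\<theta> j = (\<alpha>, \<beta> j)" for j
  define \<Omega> where "\<Omega> = space (\<Pi>\<^sub>M i\<in>{1..n}. obs_space T p)"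
  define A where "A j = {s \<in> \<Omega>. risk T p (law (\<theta> j)) (est s) - risk T p (law (\<theta> j)) (\<theta> j) < \<delta>}" for j
  have \<theta>: "\<theta> j \<in> params" for j using \<alpha> \<beta> by (simp add: \<theta>_def params_def)
  have sets_eq: "sets (\<Pi>\<^sub>M i\<in>{1..n}. law \<theta>') = sets (\<Pi>\<^sub>M i\<in>{1..n}. obs_space T p)" for \<theta>'
    by (intro sets_PiM_cong) auto
  have sp: "space (\<Pi>\<^sub>M i\<in>{1..n}. law \<theta>') = \<Omega>" for \<theta>'
    unfolding \<Omega>_def by (rule sets_eq_imp_space_eq[OF sets_eq])
  have est_m[measurable]: "est \<in> measurable (\<Pi>\<^sub>M i\<in>{1..n}. obs_space T p) (Rvec p \<Otimes>\<^sub>M L2_borel T)"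
    using est by (simp add: estimators_def)
  have A: "A j \<in> sets (\<Pi>\<^sub>M i\<in>{1..n}. obs_space T p)" for j
  proof -
    note [measurable] = measurable_compose[OF est_m risk_measurable[OF \<theta>]]
    show ?thesis unfolding A_def \<Omega>_def by measurable
  qed
  have disj: "disjoint_family A"
    unfolding disjoint_family_on_def
  proof (intro ballI impI)
    fix i j :: nat assume ij: "i \<noteq> j"
    show "A i \<inter> A j = {}"
    proof (rule ccontr)
      assume "A i \<inter> A j \<noteq> {}"
      then obtain s where s: "s \<in> A i" "s \<in> A j" by auto
      then have es: "est s \<in> params"
        using measurable_space[OF est_m] by (simp add: A_def \<Omega>_def params_eq)
      define W where "W k \<omega> = predict T p (est s) (X \<omega>) (Y \<omega>) - predict T p (\<theta> k) (X \<omega>) (Y \<omega>)" for k \<omega>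
      have W_m[measurable]: "W k \<in> borel_measurable M" for k
        unfolding W_def[abs_def] using predictor_measurable[OF es] predictor_measurable[OF \<theta>] by simp
      have W2: "integrable M (\<lambda>\<omega>. (W k \<omega>)\<^sup>2)" for k
        using integrable_square_add[of "\<lambda>\<omega>. predict T p (est s) (X \<omega>) (Y \<omega>)" M
            "\<lambda>\<omega>. - predict T p (\<theta> k) (X \<omega>) (Y \<omega>)"]
          predictor_measurable predictor_square_integrable \<theta> es by (simp add: W_def)
      have close: "(LINT \<omega>|M. (W k \<omega>)\<^sup>2) < 2 * \<delta> + 4 * (LINT \<omega>|M. (eps \<omega>)\<^sup>2)" if "k \<in> {i, j}" for k
        unfolding W_def using s that by (intro small_excess_risk_imp_close \<theta> es) (auto simp: A_def)
      have "(LINT \<omega>|M. (pairing (\<lambda>t. \<beta> i t - \<beta> j t) \<omega>)\<^sup>2) \<le> (LINT \<omega>|M. 2 * (W i \<omega>)\<^sup>2 + 2 * (W j \<omega>)\<^sup>2)"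
      proof (rule integral_mono)
        show "integrable M (\<lambda>\<omega>. (pairing (\<lambda>t. \<beta> i t - \<beta> j t) \<omega>)\<^sup>2)"
          by (intro pairing_square_integrable L2_diff \<beta>)
        fix \<omega> assume "\<omega> \<in> space M"
        then have "pairing (\<lambda>t. \<beta> i t - \<beta> j t) \<omega> = W j \<omega> - W i \<omega>"
          using pairing_diff[of "\<beta> i" "\<beta> j" \<omega>] L2_D[OF \<beta>]
          by (simp add: W_def predict_def \<theta>_def L2_inner_eq_pairing)
        moreover have "(v - w)\<^sup>2 \<le> 2 * w\<^sup>2 + 2 * v\<^sup>2" for v w :: real
          using zero_le_power2[of "v + w"] by (simp add: power2_eq_square algebra_simps)
        ultimately show "(pairing (\<lambda>t. \<beta> i t - \<beta> j t) \<omega>)\<^sup>2 \<le> 2 * (W i \<omega>)\<^sup>2 + 2 * (W j \<omega>)\<^sup>2" by simp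
      qed (use W2 in simp)
      also have "\<dots> < 4 * (2 * \<delta> + 4 * (LINT \<omega>|M. (eps \<omega>)\<^sup>2))"
        using close[of i] close[of j] W2 by simp
      finally show False using sep[OF ij] by simp
    qed
  qed
  obtain j where j: "measure (\<Pi>\<^sub>M i\<in>{1..n}. law (\<theta> j)) (A j) < \<eta>"
    using disjoint_events_bounded_KL[of "{1..n}" "law \<theta>0" UNIV "\<lambda>j. law (\<theta> j)" \<kappa> A \<eta>]
      prob_space_law \<theta> \<theta>0 KL A disj \<eta> sets_eq by (auto simp: \<theta>_def)
  interpret Pj: prob_space "\<Pi>\<^sub>M i\<in>{1..n}. law (\<theta> j)"
    by (rule prob_space_PiM) (rule prob_space_law[OF \<theta>])
  have "excess_risk_prob T p n (law (\<theta> j)) (\<theta> j) est \<delta>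
      = measure (\<Pi>\<^sub>M i\<in>{1..n}. law (\<theta> j)) (space (\<Pi>\<^sub>M i\<in>{1..n}. law (\<theta> j)) - A j)"
    unfolding excess_risk_prob_def sp by (rule arg_cong[where f = "measure _"]) (auto simp: A_def)
  also have "\<dots> = 1 - measure (\<Pi>\<^sub>M i\<in>{1..n}. law (\<theta> j)) (A j)"
    using A by (intro Pj.prob_compl) (simp add: sets_eq)
  finally show ?thesis using j by (auto simp: \<theta>_def intro!: exI[of _ j])
qed

end

section \<open>Orthogonal slopes from the spectrum\<close>

lemma eigenfunction_of_norm:
  assumes ev: "eigenvalue_sequence T A \<tau>" and k: "k \<ge> 1" and nz: "\<tau> k \<noteq> 0"
  obtains \<phi> where "\<phi> \<in> L2 T" "L2_eq T (A \<phi>) (\<lambda>t. \<tau> k * \<phi> t)" "L2_inner T \<phi> \<phi> = c\<^sup>2"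
proof -
  let ?S = "{l. 1 \<le> l \<and> \<tau> l = \<tau> k}"
  have fin: "finite ?S" and mult: "has_multiplicity T A (\<tau> k) (card ?S)"
    using ev nz by (auto simp: eigenvalue_sequence_def)
  have m: "0 < card ?S" using fin k by (auto simp: card_gt_0_iff)
  obtain e where e: "\<forall>i<card ?S. e i \<in> L2 T"
      "\<forall>i<card ?S. \<forall>j<card ?S. L2_inner T (e i) (e j) = (if i = j then 1 else 0)"
      "\<forall>f\<in>L2 T. L2_eq T (A f) (\<lambda>t. \<tau> k * f t) \<longleftrightarrow> (\<exists>c. L2_eq T f (\<lambda>t. \<Sum>i<card ?S. c i * e i t))"
    using mult unfolding has_multiplicity_def by blast
  define \<phi> where "\<phi> = (\<lambda>t. c * e 0 t)"
  have \<phi>: "\<phi> \<in> L2 T" unfolding \<phi>_def using L2_lincomb[of "e 0" T "e 0" c 0] e(1) m by simp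
  have "\<phi> = (\<lambda>t. \<Sum>i<card ?S. (if i = 0 then c else 0) * e i t)"
    using m by (simp add: \<phi>_def if_distrib[where f = "\<lambda>x. x * _"] cong: if_cong)
  then have "\<exists>c. L2_eq T \<phi> (\<lambda>t. \<Sum>i<card ?S. c i * e i t)"
    by (intro exI[of _ "\<lambda>i. if i = 0 then c else 0"]) (simp add: L2_eq_def)
  then have "L2_eq T (A \<phi>) (\<lambda>t. \<tau> k * \<phi> t)" using e(3) \<phi> by blast
  moreover have "L2_inner T \<phi> \<phi> = c\<^sup>2"
  proof -
    have "L2_inner T \<phi> \<phi> = c\<^sup>2 * L2_inner T (e 0) (e 0)"
      unfolding L2_inner_def \<phi>_def integral_mult_right_zero[symmetric]
      by (rule Bochner_Integration.integral_cong) (auto simp: power2_eq_square)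
    then show ?thesis using e(2) m by simp
  qed
  ultimately show ?thesis using that \<phi> by blast
qed

text \<open>
  With \<open>S\<close> symmetric and $\beta_i = S\phi_i$, the quadratic form is
  $\langle L_C S\phi_i, S\phi_j\rangle = \langle S L_C S\phi_i, \phi_j\rangle
  = \tau_i\langle\phi_i,\phi_j\rangle$. Its symmetry makes eigenfunctions for different eigenvalues
  orthogonal.
\<close>

lemma (in regression_model) orthogonal_slopes:
  assumes S: "nonneg_sqrt T A S"
    and ev: "eigenvalue_sequence T (\<lambda>f. S (integral_op T (covariance_fun M Y) (S f))) \<tau>"
    and pos: "\<And>k. k \<ge> 1 \<Longrightarrow> \<tau> k > 0" and inj: "inj_on \<tau> {1..}" and B: "B \<ge> 0"
  obtains \<beta> :: "nat \<Rightarrow> real \<Rightarrow> real" where "\<And>j. \<beta> j \<in> rkhs T S" "\<And>j. Cov (\<beta> j) (\<beta> j) = B"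
    "\<And>i j. i \<noteq> j \<Longrightarrow> Cov (\<beta> i) (\<beta> j) = 0"
proof -
  let ?L = "integral_op T (covariance_fun M Y)"
  have S_L2: "S f \<in> L2 T" if "f \<in> L2 T" for f
    using S that by (auto simp: nonneg_sqrt_def)
  have S_sym: "L2_inner T (S f) g = L2_inner T f (S g)" if "f \<in> L2 T" "g \<in> L2 T" for f g
    using S that by (auto simp: nonneg_sqrt_def)
  have "\<exists>\<phi>\<in>L2 T. L2_eq T (S (?L (S \<phi>))) (\<lambda>t. \<tau> (Suc j) * \<phi> t) \<and> L2_inner T \<phi> \<phi> = (sqrt (B / \<tau> (Suc j)))\<^sup>2" for j
  proof -
    have "Suc j \<ge> 1" "\<tau> (Suc j) \<noteq> 0" using pos[of "Suc j"] by simp_all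
    from eigenfunction_of_norm[OF ev this, where c = "sqrt (B / \<tau> (Suc j))"] show ?thesis by metis
  qed
  then obtain \<phi> where \<phi>: "\<And>j. \<phi> j \<in> L2 T" "\<And>j. L2_eq T (S (?L (S (\<phi> j)))) (\<lambda>t. \<tau> (Suc j) * \<phi> j t)"
      "\<And>j. L2_inner T (\<phi> j) (\<phi> j) = (sqrt (B / \<tau> (Suc j)))\<^sup>2"
    by metis
  define \<beta> where "\<beta> j = S (\<phi> j)" for j
  have \<beta>: "\<beta> j \<in> L2 T" for j unfolding \<beta>_def by (intro S_L2 \<phi>)
  have L_L2: "?L (\<beta> j) \<in> L2 T" for j
    using integral_op_square_integrable[OF L2_D[OF \<beta>]] by (simp add: L2_def integral_op_def)
  have Cov: "Cov (\<beta> i) (\<beta> j) = \<tau> (Suc i) * L2_inner T (\<phi> i) (\<phi> j)" for i j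
  proof -
    have "Cov (\<beta> i) (\<beta> j) = L2_inner T (?L (\<beta> i)) (\<beta> j)"
      using Cov_eq_integral_op[of "\<beta> i" "\<beta> j"] L2_D[OF \<beta>] by (simp add: L2_inner_def integral_op_def)
    also have "\<dots> = L2_inner T (S (?L (\<beta> i))) (\<phi> j)"
      using S_sym[OF L_L2 \<phi>(1)] by (simp add: \<beta>_def)
    also have "\<dots> = L2_inner T (\<lambda>t. \<tau> (Suc i) * \<phi> i t) (\<phi> j)"
      using \<phi>(2)[of i] L2_D[OF \<phi>(1)] by (intro L2_inner_cong S_L2 L_L2 \<phi>(1)) (auto simp: \<beta>_def)
    also have "\<dots> = \<tau> (Suc i) * L2_inner T (\<phi> i) (\<phi> j)"
      by (simp add: L2_inner_def mult.assoc)
    finally show ?thesis .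
  qed
  show ?thesis
  proof (rule that[of \<beta>])
    show "\<beta> j \<in> rkhs T S" for j
      using \<beta> \<phi>(1) by (auto simp: rkhs_def \<beta>_def L2_eq_def)
    show "Cov (\<beta> j) (\<beta> j) = B" for j
      using pos[of "Suc j"] B by (simp add: Cov \<phi>(3))
    fix i j :: nat assume "i \<noteq> j"
    then have "\<tau> (Suc i) \<noteq> \<tau> (Suc j)" using inj_onD[OF inj, of "Suc i" "Suc j"] by auto
    moreover have "Cov (\<beta> i) (\<beta> j) = Cov (\<beta> j) (\<beta> i)" using Cov_commute L2_D[OF \<beta>] by blast
    ultimately have "L2_inner T (\<phi> i) (\<phi> j) = 0"
      unfolding Cov L2_inner_commute[of T "\<phi> j"] by simp
    then show "Cov (\<beta> i) (\<beta> j) = 0" by (simp add: Cov)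
  qed
qed

section \<open>The minimax bound\<close>

text \<open>
  The hypotheses differ from the reference parameter with slope zero in the slope only. They share a
  common distance from it, which is chosen large in terms of \<open>\<delta>\<close> and the noise; their divergence from
  the reference is then bounded, however many of them are used.
\<close>

theorem (in regression_model) minimax_excess_risk_prob:
  assumes S: "nonneg_sqrt T A S"
    and ev: "eigenvalue_sequence T (\<lambda>f. S (integral_op T (covariance_fun M Y) (S f))) \<tau>"
    and pos: "\<And>k. k \<ge> 1 \<Longrightarrow> \<tau> k > 0" and inj: "inj_on \<tau> {1..}"
    and KL: "\<And>\<alpha> \<beta>1 \<beta>2. \<alpha> \<in> space (Rvec p) \<Longrightarrow> \<beta>1 \<in> rkhs T S \<Longrightarrow> \<beta>2 \<in> rkhs T S \<Longrightarrow> \<not> L2_eq T \<beta>1 \<beta>2 \<Longrightarrow>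
      KL_dist (law (\<alpha>, \<beta>1)) (law (\<alpha>, \<beta>2))
        \<le> ereal (k * (LINT \<omega>|M. (pairing (\<lambda>t. \<beta>1 t - \<beta>2 t) \<omega>)\<^sup>2))"
  shows "(INF est\<in>estimators T p n. SUP \<theta>\<in>space (Rvec p) \<times> rkhs T S.
           excess_risk_prob T p n (law \<theta>) \<theta> est \<delta>) \<ge> 1"
proof (rule cINF_greatest)
  define \<alpha> :: "nat \<Rightarrow> real" where "\<alpha> = (\<lambda>i\<in>{..<p}. 0)"
  define zero :: "real \<Rightarrow> real" where "zero = (\<lambda>_. 0)"
  have \<alpha>: "\<alpha> \<in> space (Rvec p)" by (simp add: \<alpha>_def Rvec_def space_PiM)
  have zero: "zero \<in> rkhs T S"
  proof -
    have "\<forall>f\<in>L2 T. \<forall>g\<in>L2 T. \<forall>a b. L2_eq T (S (\<lambda>t. a * f t + b * g t)) (\<lambda>t. a * S f t + b * S g t)"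
      using S by (simp add: nonneg_sqrt_def)
    from this[rule_format, OF L2_zero L2_zero, of 0 0]
    have "L2_eq T (S zero) zero" by (simp add: zero_def)
    then have "L2_eq T zero (S zero)" unfolding L2_eq_def by (rule eventually_mono) simp
    then show ?thesis using L2_zero[of T] unfolding rkhs_def zero_def by blast
  qed
  have rkhs_L2: "\<beta> \<in> L2 T" if "\<beta> \<in> rkhs T S" for \<beta> using that by (simp add: rkhs_def)
  have params: "\<theta> \<in> params" if "\<theta> \<in> space (Rvec p) \<times> rkhs T S" for \<theta>
    using that rkhs_L2 by (auto simp: params_def)
  have "(\<lambda>_. (\<alpha>, zero)) \<in> estimators T p n"
    using params[of "(\<alpha>, zero)"] \<alpha> zero by (simp add: estimators_def params_eq)
  then show "estimators T p n \<noteq> {}" by blast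
  fix est assume est: "est \<in> estimators T p n"
  define R where "R = 2 * \<delta> + 4 * (LINT \<omega>|M. (eps \<omega>)\<^sup>2)"
  define B where "B = 2 * \<bar>R\<bar> + 1"
  have B: "B > 0" using abs_ge_zero[of R] unfolding B_def by linarith
  have B_large: "4 * R \<le> 2 * B"
  proof -
    have "4 * R \<le> 4 * \<bar>R\<bar>" by simp
    also have "\<dots> \<le> 2 * B" by (simp add: B_def)
    finally show ?thesis .
  qed
  obtain \<beta> :: "nat \<Rightarrow> real \<Rightarrow> real" where \<beta>: "\<And>j. \<beta> j \<in> rkhs T S" "\<And>j. Cov (\<beta> j) (\<beta> j) = B"
      "\<And>i j. i \<noteq> j \<Longrightarrow> Cov (\<beta> i) (\<beta> j) = 0"
    using orthogonal_slopes[OF S ev pos inj, of B] B by auto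
  note \<beta>_L2 = rkhs_L2[OF \<beta>(1)]
  have sep: "(LINT \<omega>|M. (pairing (\<lambda>t. \<beta> i t - \<beta> j t) \<omega>)\<^sup>2) \<ge> 4 * R" if "i \<noteq> j" for i j
    using second_moment_diff[OF L2_D(1)[OF \<beta>_L2] L2_D(1)[OF \<beta>_L2] L2_D(2)[OF \<beta>_L2] L2_D(2)[OF \<beta>_L2], of i j]
      \<beta>(2) \<beta>(3)[OF that] B_large by simp
  have nz: "\<not> L2_eq T (\<beta> j) zero" for j
  proof
    assume "L2_eq T (\<beta> j) zero"
    then have z: "AE t in lebesgue_on T. (LINT s|lebesgue_on T. covariance_fun M Y s t * \<beta> j s) * \<beta> j t = 0"
      unfolding L2_eq_def zero_def by (rule eventually_mono) simp
    have "Cov (\<beta> j) (\<beta> j) = 0"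
      using Cov_eq_integral_op[OF L2_D(1)[OF \<beta>_L2] L2_D(1)[OF \<beta>_L2] L2_D(2)[OF \<beta>_L2] L2_D(2)[OF \<beta>_L2], of j j]
        integral_eq_zero_AE[OF z] by simp
    then show False using \<beta>(2) B by simp
  qed
  have KL': "KL_dist (law (\<alpha>, \<beta> j)) (law (\<alpha>, zero)) \<le> ereal (k * B)" for j
  proof -
    have "(LINT \<omega>|M. (pairing (\<beta> j) \<omega>)\<^sup>2) = B"
      using pairing_second_moment[OF L2_D[OF \<beta>_L2]] \<beta>(2) by (simp add: has_bochner_integral_iff Cov_def)
    then show ?thesis using KL[OF \<alpha> \<beta>(1) zero nz, of j] by (simp add: zero_def)
  qed
  let ?g = "\<lambda>\<theta>. excess_risk_prob T p n (law \<theta>) \<theta> est \<delta>"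
  have bdd: "bdd_above (?g ` (space (Rvec p) \<times> rkhs T S))"
    by (rule bdd_aboveI[of _ 1]) (use excess_risk_prob_le_1 params in blast)
  show "1 \<le> (SUP \<theta>\<in>space (Rvec p) \<times> rkhs T S. ?g \<theta>)"
  proof (rule field_le_epsilon)
    fix \<eta> :: real assume \<eta>: "\<eta> > 0"
    obtain j where "?g (\<alpha>, \<beta> j) > 1 - \<eta>"
      using excess_risk_prob_near_1[where \<beta> = \<beta>, OF est \<alpha> \<beta>_L2 sep[unfolded R_def] params[of "(\<alpha>, zero)"] KL' \<eta>] \<alpha> zero by auto
    moreover have "?g (\<alpha>, \<beta> j) \<le> (SUP \<theta>\<in>space (Rvec p) \<times> rkhs T S. ?g \<theta>)"
      using \<alpha> \<beta>(1) by (intro cSUP_upper bdd) auto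
    ultimately show "1 \<le> (SUP \<theta>\<in>space (Rvec p) \<times> rkhs T S. ?g \<theta>) + \<eta>" by linarith
  qed
qed

theorem theorem2:
  fixes M :: "'w measure" and T :: "real set"
    and K :: "real \<Rightarrow> real \<Rightarrow> real"
    and Khalf :: "(real \<Rightarrow> real) \<Rightarrow> (real \<Rightarrow> real)"
    and p :: "nat \<Rightarrow> nat"
    and X :: "nat \<Rightarrow> 'w \<Rightarrow> (nat \<Rightarrow> real)"
    and Y :: "'w \<Rightarrow> (real \<Rightarrow> real)"
    and eps :: "nat \<Rightarrow> 'w \<Rightarrow> real"
    and D :: "nat \<Rightarrow> real mat"
    and P :: "nat \<Rightarrow> param \<Rightarrow> obs measure"
    and \<tau> :: "nat \<Rightarrow> real"
    and \<sigma> K\<^sub>\<sigma> r t0 \<rho> :: real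
  defines "D \<equiv> \<lambda>n. second_moment_mat M (p n) (X n)"
    and "P \<equiv> \<lambda>n. obs_law M T (p n) (X n) Y (eps n)"
  assumes "prob_space M"
    and "compact T"
    (* the kernel and its reproducing kernel Hilbert space *)
    and "continuous_on (T \<times> T) (\<lambda>(s, t). K s t)"
    and "\<forall>s\<in>T. \<forall>t\<in>T. K s t = K t s"
    and "nonneg_def_kernel T K"
    and "nonneg_sqrt T (integral_op T K) Khalf"
    and "L2_injective T Khalf"
    and "L2_dense T (rkhs T Khalf)"
    (* the functional predictor *)
    and "(\<lambda>(\<omega>, t). Y \<omega> t) \<in> borel_measurable (M \<Otimes>\<^sub>M lebesgue_on T)"
    and "AE t in lebesgue_on T. integrable M (\<lambda>\<omega>. (Y \<omega> t)\<^sup>2) \<and> (LINT \<omega>|M. Y \<omega> t) = 0"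
    and "square_integrable_kernel T (covariance_fun M Y)"
    (* the scalar predictors and the error, for sample size n *)
    and "\<forall>n\<ge>1. p n \<ge> 1"
    and "\<forall>n\<ge>1. indep_rvs M (Rvec (p n)) (X n) (L2_borel T) Y"
    and "\<forall>n\<ge>1. \<forall>i<p n. integrable M (\<lambda>\<omega>. (X n \<omega> i)\<^sup>2) \<and> (LINT \<omega>|M. X n \<omega> i) = 0"
    and "\<forall>n\<ge>1. eps n \<in> borel_measurable M"
    and "\<forall>n\<ge>1. AE \<omega> in M.
           nn_cond_exp M (vimage_algebra (space M) (\<lambda>\<omega>. (X n \<omega>, Y \<omega>)) (Rvec (p n) \<Otimes>\<^sub>M L2_borel T))
             (\<lambda>\<omega>. ennreal ((eps n \<omega>)\<^sup>2)) \<omega> < ennreal (\<sigma>\<^sup>2)"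
    and "\<forall>n\<ge>1. AE \<omega> in M.
           real_cond_exp M (vimage_algebra (space M) (\<lambda>\<omega>. (X n \<omega>, Y \<omega>)) (Rvec (p n) \<Otimes>\<^sub>M L2_borel T))
             (eps n) \<omega> = 0"
    (* the Kullback-Leibler condition *)
    and "K\<^sub>\<sigma> > 0"
    and "\<forall>n\<ge>1. \<forall>\<beta>1\<in>rkhs T Khalf. \<forall>\<beta>2\<in>rkhs T Khalf.
           \<forall>\<alpha>1\<in>space (Rvec (p n)). \<forall>\<alpha>2\<in>space (Rvec (p n)). \<not> L2_eq T \<beta>1 \<beta>2 \<longrightarrow>
             KL_dist (P n (\<alpha>1, \<beta>1)) (P n (\<alpha>2, \<beta>2)) \<le>
               ereal (K\<^sub>\<sigma> * (LINT \<omega>|M. (L2_inner T (Y \<omega>) (\<lambda>t. \<beta>1 t - \<beta>2 t)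
                                    + vdot (p n) (X n \<omega>) (\<lambda>i. \<alpha>1 i - \<alpha>2 i))\<^sup>2))"
    (* the eigenvalues of the operator Khalf L_C Khalf *)
    and "r > 0" and "t0 > 0"
    and "eigenvalue_sequence T
           (\<lambda>f. Khalf (integral_op T (covariance_fun M Y) (Khalf f))) \<tau>"
    and "\<forall>k\<ge>1. \<tau> k = t0 * real k powr (-2 * r)"
    and "(\<lambda>n. real (p n)) \<in> O(\<lambda>n. real n powr (2 * r / (1 + 2 * r)))"
    and "\<rho> \<in> {0<..<1/8}"
  shows "\<exists>N :: nat \<Rightarrow> nat. \<forall>n\<ge>1.
    (let c = 8 * (t0 + lambda_max (D n)) * K\<^sub>\<sigma> / (\<rho> * ln 2);
         \<delta> = c powr - (2 * r / (1 + 2 * r)) *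
             ((2 powr (-2 * r) * t0 + lambda_min (D n)) /
              (2 powr (2 * r + 3) * real n powr (2 * r / (1 + 2 * r))))
     in ln (real (N n)) \<ge>
          (c powr (1 / (1 + 2 * r)) * real n powr (1 / (1 + 2 * r))
           + c powr (2 * r / (1 + 2 * r)) * real n powr (2 * r / (1 + 2 * r))) * (ln 2 / 8) \<and>
        (real n \<ge> \<rho> * ln 2 / (8 * t0 * K\<^sub>\<sigma>) \<longrightarrow> p n < n \<longrightarrow>
          (INF est\<in>estimators T (p n) n.
             SUP \<theta>\<in>space (Rvec (p n)) \<times> rkhs T Khalf.
               excess_risk_prob T (p n) n (P n \<theta>) \<theta> est \<delta>)
          \<ge> sqrt (real (N n)) / (1 + sqrt (real (N n))) *
              (1 - 4 * \<rho> - sqrt (4 * \<rho> / ln (real (N n))))))"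
proof -
  have Y: "Y \<in> measurable M (L2_borel T)"
    using assms(15) by (auto simp: indep_rvs_def)
  have model: "regression_model M T Y (p n) (X n) (eps n)" if n: "n \<ge> 1" for n
  proof -
    interpret M: prob_space M by fact
    interpret finite_measure "lebesgue_on T" by (rule finite_measure_lebesgue_on_compact) fact
    have X: "X n \<in> measurable M (Rvec (p n))" using assms(15) n by (auto simp: indep_rvs_def)
    have eps: "eps n \<in> borel_measurable M" using assms(17) n by blast
    have "integrable M (\<lambda>\<omega>. (eps n \<omega>)\<^sup>2)"
    proof (rule M.integrable_if_nn_cond_exp_bounded)
      show "(\<lambda>\<omega>. (X n \<omega>, Y \<omega>)) \<in> measurable M (Rvec (p n) \<Otimes>\<^sub>M L2_borel T)"
        using X Y by simp
      show "AE \<omega> in M. nn_cond_exp M (vimage_algebra (space M) (\<lambda>\<omega>. (X n \<omega>, Y \<omega>))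
          (Rvec (p n) \<Otimes>\<^sub>M L2_borel T)) (\<lambda>\<omega>. ennreal ((eps n \<omega>)\<^sup>2)) \<omega> \<le> ennreal (\<sigma>\<^sup>2)"
        using assms(18)[rule_format, OF n] by (rule eventually_mono) (rule less_imp_le)
    qed (use eps in auto)
    note eps_sq = this
    show ?thesis
    proof unfold_locales
      show "case_prod Y \<in> borel_measurable (M \<Otimes>\<^sub>M lebesgue_on T)" by fact
      show "integrable (lebesgue_on T) (\<lambda>t. (Y \<omega> t)\<^sup>2)" if "\<omega> \<in> space M" for \<omega>
        using measurable_space[OF Y that] by (simp add: space_L2_borel L2_def)
      show "AE t in lebesgue_on T. integrable M (\<lambda>\<omega>. (Y \<omega> t)\<^sup>2)"
        using assms(12) by (rule eventually_mono) simp
      show "case_prod (covariance_fun M Y) \<in> borel_measurable (lebesgue_on T \<Otimes>\<^sub>M lebesgue_on T)"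
        "integrable (lebesgue_on T \<Otimes>\<^sub>M lebesgue_on T) (\<lambda>(s, t). (covariance_fun M Y s t)\<^sup>2)"
        using assms(13) unfolding square_integrable_kernel_def by auto
      show "integrable M (\<lambda>\<omega>. (X n \<omega> i)\<^sup>2)" if "i < p n" for i
        using assms(16) n that by blast
    qed (fact | rule covariance_fun_def)+
  qed
  have \<tau>: "\<tau> k > 0" if "k \<ge> 1" for k
    using that assms(23,25) by simp
  have inj: "inj_on \<tau> {1..}"
  proof (rule inj_onI)
    fix i j :: nat assume ij: "i \<in> {1..}" "j \<in> {1..}" "\<tau> i = \<tau> j"
    then have "real i powr (-2 * r) = real j powr (-2 * r)" using assms(23,25) by simp
    then have "ln (real i powr (-2 * r)) = ln (real j powr (-2 * r))" by simp
    then show "i = j" using ij assms(22) by (simp add: ln_powr)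
  qed
  define bound where "bound n =
    (let c = 8 * (t0 + lambda_max (D n)) * K\<^sub>\<sigma> / (\<rho> * ln 2)
     in (c powr (1 / (1 + 2 * r)) * real n powr (1 / (1 + 2 * r))
         + c powr (2 * r / (1 + 2 * r)) * real n powr (2 * r / (1 + 2 * r))) * (ln 2 / 8))" for n
  (* The summand 2 keeps \<open>ln (N n)\<close> positive. *)
  define N where "N n = nat \<lceil>exp (bound n)\<rceil> + 2" for n
  have N: "bound n \<le> ln (real (N n))" for n
  proof -
    have "exp (bound n) \<le> real (N n)" by (simp add: N_def) linarith
    then have "ln (exp (bound n)) \<le> ln (real (N n))" by (intro ln_mono) auto
    then show ?thesis by simp
  qed
  have le1: "sqrt (real (N n)) / (1 + sqrt (real (N n))) * (1 - 4 * \<rho> - sqrt (4 * \<rho> / ln (real (N n)))) \<le> 1" for n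
  proof -
    have "N n \<ge> 1" by (simp add: N_def)
    then have "real (N n) \<ge> 1" by simp
    then have "4 * \<rho> / ln (real (N n)) \<ge> 0"
      using assms(27) by (intro divide_nonneg_nonneg ln_ge_zero) auto
    then have "sqrt (4 * \<rho> / ln (real (N n))) \<ge> 0" by (rule real_sqrt_ge_zero)
    moreover have "\<rho> > 0" using assms(27) by simp
    ultimately have 1: "1 - 4 * \<rho> - sqrt (4 * \<rho> / ln (real (N n))) \<le> 1" by linarith
    have "x \<ge> 0 \<Longrightarrow> 0 \<le> x / (1 + x) \<and> x / (1 + x) \<le> 1" for x :: real by simp
    from this[of "sqrt (real (N n))"] have 2: "0 \<le> sqrt (real (N n)) / (1 + sqrt (real (N n)))"
      "sqrt (real (N n)) / (1 + sqrt (real (N n))) \<le> 1"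
      by auto
    show ?thesis
      using mult_left_mono[OF 1 2(1)] 2(2) by linarith
  qed
  have minimax: "(INF est\<in>estimators T (p n) n. SUP \<theta>\<in>space (Rvec (p n)) \<times> rkhs T Khalf.
      excess_risk_prob T (p n) n (P n \<theta>) \<theta> est \<delta>) \<ge> 1" if n: "n \<ge> 1" for n \<delta>
  proof -
    interpret regression_model M T Y "p n" "X n" "eps n" by (rule model[OF n])
    show ?thesis
      unfolding P_def
    proof (rule minimax_excess_risk_prob[OF assms(8,24) \<tau> inj, where k = K\<^sub>\<sigma>])
      fix \<alpha> \<beta>1 \<beta>2
      assume *: "\<alpha> \<in> space (Rvec (p n))" "\<beta>1 \<in> rkhs T Khalf" "\<beta>2 \<in> rkhs T Khalf" "\<not> L2_eq T \<beta>1 \<beta>2"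
      have "vdot (p n) x (\<lambda>i. \<alpha> i - \<alpha> i) = 0" for x by (simp add: vdot_def)
      then show "KL_dist (law (\<alpha>, \<beta>1)) (law (\<alpha>, \<beta>2))
          \<le> ereal (K\<^sub>\<sigma> * (LINT \<omega>|M. (pairing (\<lambda>t. \<beta>1 t - \<beta>2 t) \<omega>)\<^sup>2))"
        using assms(21)[rule_format, OF n *(2,3,1,1,4)] by (simp add: P_def L2_inner_eq_pairing)
    qed
  qed
  show ?thesis
  proof (intro exI[of _ N] allI impI)
    fix n :: nat assume n: "n \<ge> 1"
    show "let c = 8 * (t0 + lambda_max (D n)) * K\<^sub>\<sigma> / (\<rho> * ln 2);
         \<delta> = c powr - (2 * r / (1 + 2 * r)) *
             ((2 powr (-2 * r) * t0 + lambda_min (D n)) /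
              (2 powr (2 * r + 3) * real n powr (2 * r / (1 + 2 * r))))
     in ln (real (N n)) \<ge>
          (c powr (1 / (1 + 2 * r)) * real n powr (1 / (1 + 2 * r))
           + c powr (2 * r / (1 + 2 * r)) * real n powr (2 * r / (1 + 2 * r))) * (ln 2 / 8) \<and>
        (real n \<ge> \<rho> * ln 2 / (8 * t0 * K\<^sub>\<sigma>) \<longrightarrow> p n < n \<longrightarrow>
          (INF est\<in>estimators T (p n) n.
             SUP \<theta>\<in>space (Rvec (p n)) \<times> rkhs T Khalf.
               excess_risk_prob T (p n) n (P n \<theta>) \<theta> est \<delta>)
          \<ge> sqrt (real (N n)) / (1 + sqrt (real (N n))) *
              (1 - 4 * \<rho> - sqrt (4 * \<rho> / ln (real (N n)))))"
      using N[of n] unfolding bound_def Let_def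
      by (intro conjI impI order.trans[OF le1[of n] minimax[OF n]])
  qed
qed

end
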